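(* Let $n\ge2$ and let $\{n_1,n_2,\dots,n_k,1\}$ be the canonical sequence of an optimal set of $n$-means for the measure $P$ below. For $1\le i\le k$ let $A(i)=\{n_1,\dots,n_{i-1},n_i+1,n_{i+1},\dots,n_k\}$ and set \[V(A(i)):=\sum_{\substack{j=1\\ j\neq i}}^k\frac{1}{n_j^2}\frac{1}{12}\frac{1}{18^j}+\frac{1}{(n_i+1)^2}\frac{1}{12}\frac{1}{18^i}+\frac{25}{204}\frac{1}{18^k},\] \[V(\infty):=\sum_{j=1}^k\frac{1}{n_j^2}\frac{1}{12}\frac{1}{18^j}+\frac{1}{12}\frac{1}{18^{k+1}}+\frac{25}{204}\frac{1}{18^{k+1}}.\] Let $V_{\min}:=\min\{\min\{V(A(j)):1\le j\le k\},V(\infty)\}$. If $V_{\min}=V(A(m))$ for some $1\le m\le k$, then $\{n_1,\dots,n_{m-1},n_m+1,n_{m+1},\dots,n_k,1\}$ is the canonical sequence which gives an optimal set of $(n+1)$-means. If $V_{\min}=V(\infty)$, then $\{n_1,n_2,\dots,n_k,1,1\}$ is the canonical sequence which gives an optimal set of $(n+1)$-means.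
   Context: $P$ is the Borel probability measure on $\mathbb{R}$ with density $f(x)=(3/2)^m$ if $x\in J_m:=[1-\frac{1}{3^{m-1}},1-\frac{2}{3^m}]$ for some $m\in\mathbb{N}=\{1,2,\dots\}$, and $f(x)=0$ otherwise. An optimal set of $n$-means for $P$ is a set $\alpha$ with $\mathrm{card}(\alpha)\le n$ attaining $\inf\{\int\min_{a\in\alpha}(x-a)^2\,dP(x):\mathrm{card}(\alpha)\le n\}$. Canonical sequence: for $n\ge2$ and an optimal set $\alpha_n$ of $n$-means for $P$, there is a (unique) positive integer $k$ with $\alpha_n\cap J_j\neq\emptyset$ for $1\le j\le k$ and $\mathrm{card}(\alpha_n\cap[1-\frac{1}{3^k},1])=1$; with $n_j:=\mathrm{card}(\alpha_n\cap J_j)$, the sequence $\{n_1,\dots,n_k,1\}$ is called the canonical sequence of order $n$ associated with $\alpha_n$. Conversely a canonical sequence determines the optimal set: $\alpha_n\cap J_j$ consists of the $n_j$ points $1-\frac{1}{3^{j-1}}+\frac{2i-1}{2n_j}\frac{1}{3^j}$, $1\le i\le n_j$, and the remaining point of $\alpha_n$ is $1-\frac{1}{2}\frac{1}{3^k}$. *)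

theory Defs
  imports "HOL-Analysis.Analysis"
begin

definition J :: "nat \<Rightarrow> real set" where
  "J m = {1 - 1 / 3 ^ (m - 1) .. 1 - 2 / 3 ^ m}"

text \<open>Density of P: (3/2)^m on J_m (m \<ge> 1), 0 elsewhere (the J_m are pairwise disjoint).\<close>
definition dens :: "real \<Rightarrow> ennreal" where
  "dens x = (\<Sum>m. ennreal ((3/2) ^ Suc m) * indicator (J (Suc m)) x)"

definition P :: "real measure" where
  "P = density lborel dens"

definition distortion :: "real set \<Rightarrow> ennreal" where
  "distortion \<alpha> = (\<integral>\<^sup>+ x. ennreal (Min ((\<lambda>a. (x - a) ^ 2) ` \<alpha>)) \<partial>P)"

definition optimal_set :: "nat \<Rightarrow> real set \<Rightarrow> bool" where
  "optimal_set n \<alpha> \<longleftrightarrow> finite \<alpha> \<and> \<alpha> \<noteq> {} \<and> card \<alpha> \<le> n \<and>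
     (\<forall>\<beta>. finite \<beta> \<and> \<beta> \<noteq> {} \<and> card \<beta> \<le> n \<longrightarrow> distortion \<alpha> \<le> distortion \<beta>)"

text \<open>The list ns = [n_1,...,n_k] represents the canonical sequence {n_1,...,n_k,1};
  k = length ns.  Index j (1-based) corresponds to ns ! (j-1).\<close>
definition canonical_seq :: "real set \<Rightarrow> nat list \<Rightarrow> bool" where
  "canonical_seq \<alpha> ns \<longleftrightarrow> ns \<noteq> [] \<and>
     (\<forall>j\<in>{1..length ns}. \<alpha> \<inter> J j \<noteq> {} \<and> card (\<alpha> \<inter> J j) = ns ! (j - 1)) \<and>
     card (\<alpha> \<inter> {1 - 1 / 3 ^ length ns .. 1}) = 1"

definition canon_set :: "nat list \<Rightarrow> real set" where
  "canon_set ns = (\<Union>j\<in>{1..length ns}.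
      {1 - 1 / 3 ^ (j - 1) + (2 * real i - 1) / (2 * real (ns ! (j - 1))) * (1 / 3 ^ j) | i.
         i \<in> {1..ns ! (j - 1)}})
    \<union> {1 - 1/2 * (1 / 3 ^ length ns)}"

definition VA :: "nat list \<Rightarrow> nat \<Rightarrow> real" where
  "VA ns i = (\<Sum>j\<in>{1..length ns} - {i}. 1 / real (ns ! (j - 1)) ^ 2 * (1/12) * (1 / 18 ^ j))
     + 1 / (real (ns ! (i - 1)) + 1) ^ 2 * (1/12) * (1 / 18 ^ i)
     + 25/204 * (1 / 18 ^ length ns)"

definition Vinf :: "nat list \<Rightarrow> real" where
  "Vinf ns = (\<Sum>j\<in>{1..length ns}. 1 / real (ns ! (j - 1)) ^ 2 * (1/12) * (1 / 18 ^ j))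
     + 1/12 * (1 / 18 ^ (length ns + 1)) + 25/204 * (1 / 18 ^ (length ns + 1))"

definition Vmin :: "nat list \<Rightarrow> real" where
  "Vmin ns = min (Min (VA ns ` {1..length ns})) (Vinf ns)"

end

theory Submission
  imports Defs
begin

text \<open>
  The measure splits as \<open>P = PL + PR\<close>, where \<open>PL\<close> is half the uniform distribution on \<open>J 1 = [0, 1/3]\<close>
  and \<open>PR\<close> is half the image of \<open>P\<close> under \<open>t \<mapsto> t/3 + 2/3\<close>. The key point is that a set of at least
  two points never profits from a point serving both sides of the gap \<open>(1/3, 2/3)\<close>: if the Voronoi cell
  of such a point has masses \<open>m1, m2 > 0\<close> on the two sides, then giving the point to the right
  (if \<open>m1 \<le> 2 m2\<close>) or to the left (otherwise) and repairing the other side strictly lowers the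
  distortion. Hence optimal sets split into a uniform quantizer of \<open>J 1\<close> and a scaled optimal set, so by
  recursion optimal sets are canonical, and the distortion of every finite set is bounded below by that
  of a canonical sequence of at most the same order. The distortion of a canonical sequence is a constant
  minus a sum of gains that decrease along each block and along the tail, so the greedy step is optimal.
\<close>

section \<open>The measure and its moments\<close>

text \<open>The factor 2 between \<open>m1\<close> and \<open>m2\<close> balances two exchanges. Let
  \<open>e\<close> and \<open>f\<close> be the distances from the straddling point to the half-lines
  \<open>{..1/3}\<close> and \<open>{2/3..}\<close>. Giving up its left cell costs at most 1/36 -
  e^2 per unit of mass and gains f^2 on the right; giving up its right cell costs at most 1/16 - f^2
  and gains e^2 on the left. Because e + f is at least the gap length 1/3, both estimates close for
  every factor strictly between 9/7 and 3. The two sides are repaired differently: on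
  \<open>J 1\<close> a sharp bound for a given number of points is available, so the left part can
  be rebuilt as a uniform set, while the error on the right is only known recursively. There the
  points right of the straddling one are kept, or the single point 5/6 replaces them. A cell of mass
  zero yields no strict gain, hence the dichotomy of \<open>splittable\<close> and
  \<open>improvable\<close>. Every finite set is compared with a sequence through
  \<open>cost\<close>, and \<open>canon_set\<close> attains that bound; the existence of optimal
  sets of n + 1 points comes out of the same comparison.\<close>

definition tmap :: "real \<Rightarrow> real" where
  "tmap t = t / 3 + 2 / 3"

definition PL :: "real measure" where
  "PL = density lborel (\<lambda>x. ennreal (3/2) * indicator {0..1/3} x)"

definition PR :: "real measure" where
  "PR = density lborel (\<lambda>x. ennreal (3/2) * dens (3 * x - 2))"

lemma J_1: "J 1 = {0..1/3}"
  by (simp add: J_def)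

lemma J_Suc_iff: "x \<in> J (Suc (Suc m)) \<longleftrightarrow> 3 * x - 2 \<in> J (Suc m)"
  by (auto simp: J_def field_simps)

lemma tmap_in_J_iff: "m \<ge> 1 \<Longrightarrow> tmap x \<in> J (Suc m) \<longleftrightarrow> x \<in> J m"
  using J_Suc_iff[of "tmap x" "m - 1"] by (simp add: tmap_def)

lemma J_subset_unit: "m \<ge> 1 \<Longrightarrow> J m \<subseteq> {0..1}"
proof -
  assume "m \<ge> 1"
  have "(1::real) / 3 ^ (m - 1) \<le> 1" by simp
  then show ?thesis by (auto simp: J_def intro: order_trans)
qed

lemma measurable_J [measurable]: "J m \<in> sets borel"
  by (simp add: J_def)

lemma measurable_dens [measurable]: "dens \<in> borel_measurable borel"
  unfolding dens_def by measurable

lemma measurable_tmap [measurable]: "tmap \<in> borel_measurable borel"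
  unfolding tmap_def by measurable

lemma sets_measures [simp, measurable_cong]:
  "sets P = sets borel" "sets PL = sets borel" "sets PR = sets borel"
  by (simp_all add: P_def PL_def PR_def)

lemma space_measures [simp]: "space P = UNIV" "space PL = UNIV" "space PR = UNIV"
  by (simp_all add: P_def PL_def PR_def)

text \<open>The term with index 0 is the density on \<open>J 1\<close>; by \<open>J_Suc_iff\<close>
  the remaining terms are the same series at \<open>3 * x - 2\<close>, with one factor 3/2 pulled
  out.\<close>

lemma dens_split:
  "dens x = ennreal (3/2) * indicator {0..1/3} x + ennreal (3/2) * dens (3 * x - 2)"
proof -
  let ?f = "\<lambda>m. ennreal ((3/2) ^ Suc m) * indicator (J (Suc m)) x"
  have "?f (Suc m) = ennreal (3/2) * (ennreal ((3/2) ^ Suc m) * indicator (J (Suc m)) (3 * x - 2))" for m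
  proof -
    have "ennreal ((3/2) ^ Suc (Suc m)) = ennreal (3/2) * ennreal ((3/2) ^ Suc m)"
      by (subst ennreal_mult[symmetric]) auto
    then show ?thesis
      using J_Suc_iff[of x m] by (simp add: indicator_def mult.assoc del: power_Suc)
  qed
  then have *: "(\<Sum>m. ?f (Suc m)) = ennreal (3/2) * dens (3 * x - 2)"
    by (simp add: dens_def del: power_Suc)
  have "?f sums ((\<Sum>m. ?f (Suc m)) + ?f 0)"
    by (rule sums_Suc[OF summable_sums]) simp
  then have "suminf ?f = (\<Sum>m. ?f (Suc m)) + ?f 0"
    by (rule sums_unique[symmetric])
  then show ?thesis
    unfolding * by (simp add: dens_def J_1[simplified] add.commute)
qed

lemma dens_eq_0: "x \<notin> {0..1} \<Longrightarrow> dens x = 0"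
proof -
  assume "x \<notin> {0..1}"
  then have "x \<notin> J (Suc m)" for m
    using J_subset_unit[of "Suc m"] by auto
  then show ?thesis by (simp add: dens_def)
qed

lemma nn_integral_PR:
  assumes [measurable]: "g \<in> borel_measurable borel"
  shows "(\<integral>\<^sup>+x. g x \<partial>PR) = ennreal (1/2) * (\<integral>\<^sup>+x. g (tmap x) \<partial>P)"
proof -
  have "(\<integral>\<^sup>+x. g x \<partial>PR) = (\<integral>\<^sup>+x. ennreal (3/2) * (dens (3 * x - 2) * g x) \<partial>lborel)"
    by (simp add: PR_def nn_integral_density mult.assoc)
  also have "\<dots> = ennreal (3/2) * (\<integral>\<^sup>+x. dens (3 * x - 2) * g x \<partial>lborel)"
    by (rule nn_integral_cmult) measurable
  \<comment> \<open>Substitution along \<open>tmap\<close>: its Jacobian 1/3 and the density factor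
    3/2 leave the mass 1/2.\<close>
  also have "(\<integral>\<^sup>+x. dens (3 * x - 2) * g x \<partial>lborel) = ennreal (1/3) * (\<integral>\<^sup>+x. dens x * g (tmap x) \<partial>lborel)"
    by (subst nn_integral_real_affine[where c = "1/3" and t = "2/3"])
       (auto simp: tmap_def algebra_simps)
  also have "(\<integral>\<^sup>+x. dens x * g (tmap x) \<partial>lborel) = (\<integral>\<^sup>+x. g (tmap x) \<partial>P)"
    by (simp add: P_def nn_integral_density)
  also have "ennreal (3/2) * (ennreal (1/3) * (\<integral>\<^sup>+x. g (tmap x) \<partial>P)) =
      ennreal (1/2) * (\<integral>\<^sup>+x. g (tmap x) \<partial>P)"
    by (subst mult.assoc[symmetric], subst ennreal_mult[symmetric]) auto
  finally show ?thesis .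
qed

lemma nn_integral_P:
  assumes [measurable]: "g \<in> borel_measurable borel"
  shows "(\<integral>\<^sup>+x. g x \<partial>P) = (\<integral>\<^sup>+x. g x \<partial>PL) + (\<integral>\<^sup>+x. g x \<partial>PR)"
proof -
  have "(\<integral>\<^sup>+x. g x \<partial>P) = (\<integral>\<^sup>+x. dens x * g x \<partial>lborel)"
    by (simp add: P_def nn_integral_density)
  also have "\<dots> = (\<integral>\<^sup>+x. ennreal (3/2) * indicator {0..1/3} x * g x +
      ennreal (3/2) * dens (3 * x - 2) * g x \<partial>lborel)"
    by (subst dens_split) (simp only: distrib_right)
  also have "\<dots> = (\<integral>\<^sup>+x. ennreal (3/2) * indicator {0..1/3} x * g x \<partial>lborel) +
      (\<integral>\<^sup>+x. ennreal (3/2) * dens (3 * x - 2) * g x \<partial>lborel)"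
    by (rule nn_integral_add) measurable
  finally show ?thesis
    by (simp add: PL_def PR_def nn_integral_density)
qed

lemma emeasure_P: "emeasure P UNIV = 1"
proof -
  have "emeasure P UNIV = (\<integral>\<^sup>+x. dens x \<partial>lborel)"
    by (simp add: P_def emeasure_density)
  also have "\<dots> = (\<Sum>m. ennreal ((3/2) ^ Suc m) * emeasure lborel (J (Suc m)))"
    unfolding dens_def by (subst nn_integral_suminf) (simp_all add: nn_integral_cmult_indicator del: power_Suc)
  also have "\<dots> = (\<Sum>m. ennreal ((1/2) ^ Suc m))"
  proof (intro suminf_cong)
    fix m
    have "emeasure lborel (J (Suc m)) = ennreal ((1/3) ^ Suc m)"
      unfolding J_def by (subst emeasure_lborel_Icc) (auto simp: field_simps)
    then show "ennreal ((3/2) ^ Suc m) * emeasure lborel (J (Suc m)) = ennreal ((1/2) ^ Suc m)"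
      by (simp add: ennreal_mult[symmetric] power_mult_distrib[symmetric] del: power_Suc)
  qed
  also have "\<dots> = ennreal 1"
    by (rule suminf_ennreal_eq[OF _ power_half_series]) auto
  finally show ?thesis by simp
qed

lemma emeasure_PL: "emeasure PL UNIV = ennreal (1/2)"
proof -
  have "emeasure PL UNIV = (\<integral>\<^sup>+x. ennreal (3/2) * indicator {0..1/3::real} x \<partial>lborel)"
    by (simp add: PL_def emeasure_density)
  also have "\<dots> = ennreal (3/2) * ennreal (1/3)"
    by (subst nn_integral_cmult_indicator) auto
  also have "\<dots> = ennreal (1/2)"
    by (subst ennreal_mult[symmetric]) auto
  finally show ?thesis .
qed

lemma emeasure_PR: "emeasure PR UNIV = ennreal (1/2)"
  using nn_integral_PR[of "\<lambda>_. 1"] emeasure_P by simp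

interpretation P: finite_measure P
  by (rule finite_measureI) (simp add: emeasure_P)
interpretation PL: finite_measure PL
  by (rule finite_measureI) (simp add: emeasure_PL)
interpretation PR: finite_measure PR
  by (rule finite_measureI) (simp add: emeasure_PR)

lemma measure_P [simp]: "measure P UNIV = 1"
  by (simp add: measure_def emeasure_P)
lemma measure_PL [simp]: "measure PL UNIV = 1/2"
  unfolding measure_def emeasure_PL by (subst enn2real_ennreal) auto
lemma measure_PR [simp]: "measure PR UNIV = 1/2"
  unfolding measure_def emeasure_PR by (subst enn2real_ennreal) auto

lemma AE_P: "AE x in P. x \<in> {0..1}"
proof -
  have "0 < dens x \<Longrightarrow> x \<in> {0..1}" for x
    using dens_eq_0[of x] by force
  then show ?thesis
    unfolding P_def by (subst AE_density) (auto intro!: AE_I2)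
qed

lemma AE_PL: "AE x in PL. x \<in> {0..1/3}"
  unfolding PL_def by (subst AE_density) (auto intro!: AE_I2 split: split_indicator)

lemma AE_PR: "AE x in PR. x \<in> {2/3..1}"
proof -
  have "dens (3 * x - 2) = 0" if "x \<notin> {2/3..1}" for x
    using that by (intro dens_eq_0) auto
  then have "0 < dens (3 * x - 2) \<Longrightarrow> x \<in> {2/3..1}" for x
    by force
  then show ?thesis
    unfolding PR_def by (subst AE_density) (auto intro!: AE_I2 simp: ennreal_zero_less_mult_iff)
qed

section \<open>Transfer of integrals between the three measures, and second moments\<close>

lemma integrable_continuous:
  fixes f :: "real \<Rightarrow> real"
  assumes f: "continuous_on UNIV f" and "finite_measure M" and sets: "sets M = sets borel"
    and AE: "AE x in M. x \<in> {a..b}"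
  shows "integrable M f"
proof -
  interpret finite_measure M by fact
  have "compact (f ` {a..b})"
    by (intro compact_continuous_image continuous_on_subset[OF f]) auto
  then obtain B where B: "\<And>x. x \<in> {a..b} \<Longrightarrow> norm (f x) \<le> B"
    by (meson bounded_iff compact_imp_bounded image_eqI)
  have "f \<in> borel_measurable M"
    using borel_measurable_continuous_onI[OF f] sets by (simp cong: measurable_cong_sets)
  with AE B show ?thesis
    by (intro integrable_const_bound[where B = B]) auto
qed

lemma integrable_continuous_measures:
  fixes f :: "real \<Rightarrow> real"
  assumes "continuous_on UNIV f"
  shows "integrable P f" "integrable PL f" "integrable PR f"
  using integrable_continuous[OF assms _ _ AE_P] integrable_continuous[OF assms _ _ AE_PL]
    integrable_continuous[OF assms _ _ AE_PR] P.finite_measure_axioms PL.finite_measure_axioms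
    PR.finite_measure_axioms by simp_all

lemma integral_P_nonneg:
  fixes f :: "real \<Rightarrow> real"
  assumes f: "continuous_on UNIV f" and "\<And>x. f x \<ge> 0"
  shows "integral\<^sup>L P f = integral\<^sup>L PL f + integral\<^sup>L PR f"
    and "integral\<^sup>L PR f = 1/2 * integral\<^sup>L P (\<lambda>x. f (tmap x))"
proof -
  have m [measurable]: "f \<in> borel_measurable borel"
    by (rule borel_measurable_continuous_onI[OF f])
  have "continuous_on UNIV (\<lambda>x. f (tmap x))"
    unfolding tmap_def by (intro continuous_on_compose2[OF f] continuous_intros) auto
  note int = integrable_continuous_measures[OF f] integrable_continuous_measures[OF this]
  note nn = nn_integral_eq_integral[OF int(1)] nn_integral_eq_integral[OF int(2)]
    nn_integral_eq_integral[OF int(3)] nn_integral_eq_integral[OF int(4)]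
  have "ennreal (integral\<^sup>L P f) = ennreal (integral\<^sup>L PL f + integral\<^sup>L PR f)"
    using nn_integral_P[of "\<lambda>x. ennreal (f x)"] nn assms(2)
    by (simp add: ennreal_plus[symmetric] del: ennreal_plus)
  then show "integral\<^sup>L P f = integral\<^sup>L PL f + integral\<^sup>L PR f"
    using assms(2) by (subst (asm) ennreal_inj) (auto intro!: add_nonneg_nonneg)
  have "ennreal (integral\<^sup>L PR f) = ennreal (1/2 * integral\<^sup>L P (\<lambda>x. f (tmap x)))"
    using nn_integral_PR[of "\<lambda>x. ennreal (f x)"] nn assms(2)
    by (subst ennreal_mult) auto
  then show "integral\<^sup>L PR f = 1/2 * integral\<^sup>L P (\<lambda>x. f (tmap x))"
    using assms(2) by (subst (asm) ennreal_inj) auto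
qed

lemma integral_PL:
  fixes f :: "real \<Rightarrow> real"
  assumes [measurable]: "f \<in> borel_measurable borel"
  shows "integral\<^sup>L PL f = 3/2 * (LINT x:{0..1/3}|lborel. f x)"
proof -
  have "PL = density lborel (\<lambda>x. ennreal (3/2 * indicator {0..1/3} x))"
    unfolding PL_def by (intro density_cong) (auto split: split_indicator)
  moreover have "integral\<^sup>L (density lborel (\<lambda>x. ennreal (3/2 * indicator {0..1/3} x))) f =
      (\<integral>x. (3/2 * indicator {0..1/3} x) * f x \<partial>lborel)"
    by (subst integral_density) auto
  ultimately show ?thesis
    by (simp add: set_lebesgue_integral_def mult.assoc)
qed

lemma integral_square:
  fixes c p q :: real
  assumes "p \<le> q"
  shows "(LINT x:{p..q}|lborel. (x - c)\<^sup>2) = ((q - c) ^ 3 - (p - c) ^ 3) / 3"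
proof -
  have "(LINT x:{p..q}|lborel. (x - c)\<^sup>2) = (q - c) ^ 3 / 3 - (p - c) ^ 3 / 3"
    unfolding set_lebesgue_integral_def
    using assms
    by (intro integral_FTC_atLeastAtMost[where F = "\<lambda>x. (x - c) ^ 3 / 3"])
       (auto intro!: derivative_eq_intros continuous_intros
         simp flip: has_real_derivative_iff_has_vector_derivative)
  then show ?thesis by (simp add: diff_divide_distrib)
qed

text \<open>Steiner's formula for mass 1/2: the mean is 1/6 and the variance of the uniform law on
  an interval of length 1/3 is 1/108.\<close>

lemma integral_PL_square: "(\<integral>x. (x - c)\<^sup>2 \<partial>PL) = 1/216 + 1/2 * (c - 1/6)\<^sup>2"
  by (simp add: integral_PL integral_square) (simp add: field_simps power2_eq_square power3_eq_cube)

text \<open>Self-similarity determines the first two moments: the split of \<open>P\<close> gives a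
  relation between \<open>m1\<close> and \<open>m2\<close> for every \<open>c\<close>, and two
  values of \<open>c\<close> suffice to solve it. Mean 1/2 and variance 25/204 result.\<close>

lemma integral_P_square: "(\<integral>x. (x - c)\<^sup>2 \<partial>P) = 25/204 + (c - 1/2)\<^sup>2"
proof -
  have i: "integrable P (\<lambda>x. x ^ k)" for k
    by (intro integrable_continuous_measures continuous_intros)
  define m1 where "m1 = (\<integral>x. x \<partial>P)"
  define m2 where "m2 = (\<integral>x. x\<^sup>2 \<partial>P)"
  have sq: "(\<integral>x. (x - c)\<^sup>2 \<partial>P) = m2 - 2 * c * m1 + c\<^sup>2" for c
    using i[of 1] i[of 2] by (simp add: power2_diff m1_def m2_def mult.assoc[symmetric])
  have rec: "m2 - 2 * c * m1 + c\<^sup>2 = 1/216 + 1/2 * (c - 1/6)\<^sup>2 + (m2 - 2 * (3 * c - 2) * m1 + (3 * c - 2)\<^sup>2) / 18" for c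
  proof -
    have "(\<integral>x. (x - c)\<^sup>2 \<partial>P) = (\<integral>x. (x - c)\<^sup>2 \<partial>PL) + 1/2 * (\<integral>x. (tmap x - c)\<^sup>2 \<partial>P)"
      using integral_P_nonneg[of "\<lambda>x. (x - c)\<^sup>2"] by (simp add: continuous_on_power continuous_on_diff)
    also have "(\<lambda>x. (tmap x - c)\<^sup>2) = (\<lambda>x. (x - (3 * c - 2))\<^sup>2 / 9)"
      by (auto simp: tmap_def fun_eq_iff field_simps power2_eq_square)
    finally show ?thesis unfolding sq integral_PL_square by (simp add: sq)
  qed
  have "m1 = 1/2" "m2 = 19/51"
    using rec[of 0] rec[of 1] by (simp_all add: power2_eq_square field_simps)
  then show ?thesis unfolding sq by (simp add: power2_eq_square field_simps)
qed

lemma integral_PR_square: "(\<integral>x. (x - c)\<^sup>2 \<partial>PR) = 25/204/18 + 1/2 * (c - 5/6)\<^sup>2"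
proof -
  have "(\<integral>x. (x - c)\<^sup>2 \<partial>PR) = (\<integral>x. (x - c)\<^sup>2 \<partial>P) - (\<integral>x. (x - c)\<^sup>2 \<partial>PL)"
    using integral_P_nonneg(1)[of "\<lambda>x. (x - c)\<^sup>2"] by (simp add: continuous_on_power continuous_on_diff)
  also have "\<dots> = 25/204/18 + 1/2 * (c - 5/6)\<^sup>2"
    by (simp add: integral_PL_square integral_P_square) (simp add: field_simps power2_eq_square)
  finally show ?thesis .
qed

section \<open>Distortion and uniform quantization\<close>

definition mind :: "real set \<Rightarrow> real \<Rightarrow> real" where
  "mind S t = Min ((\<lambda>a. (t - a)\<^sup>2) ` S)"

lemma mind_singleton [simp]: "mind {a} t = (t - a)\<^sup>2"
  by (simp add: mind_def)

lemma mind_insert: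
  "finite S \<Longrightarrow> S \<noteq> {} \<Longrightarrow> mind (insert a S) t = min ((t - a)\<^sup>2) (mind S t)"
  by (simp add: mind_def)

lemma mind_le: "finite S \<Longrightarrow> a \<in> S \<Longrightarrow> mind S t \<le> (t - a)\<^sup>2"
  by (simp add: mind_def)

lemma mind_ge: "finite S \<Longrightarrow> S \<noteq> {} \<Longrightarrow> (\<And>a. a \<in> S \<Longrightarrow> c \<le> (t - a)\<^sup>2) \<Longrightarrow> c \<le> mind S t"
  by (simp add: mind_def)

lemma mind_mono: "finite S \<Longrightarrow> R \<subseteq> S \<Longrightarrow> R \<noteq> {} \<Longrightarrow> mind S t \<le> mind R t"
  by (meson finite_subset mind_ge mind_le subsetD)

lemma mind_nonneg: "finite S \<Longrightarrow> S \<noteq> {} \<Longrightarrow> 0 \<le> mind S t"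
  by (simp add: mind_ge)

lemma mind_attained:
  assumes "finite S" "S \<noteq> {}"
  obtains a where "a \<in> S" "mind S t = (t - a)\<^sup>2"
proof -
  have "mind S t \<in> (\<lambda>a. (t - a)\<^sup>2) ` S"
    unfolding mind_def using assms by (intro Min_in) auto
  then show ?thesis using that by auto
qed

lemma continuous_on_mind:
  assumes "finite S" "S \<noteq> {}"
  shows "continuous_on UNIV (mind S)"
  using assms
proof (induction S rule: finite_ne_induct)
  case (singleton x)
  then show ?case by (simp add: mind_singleton[abs_def] continuous_on_power continuous_on_diff)
next
  case (insert x F)
  then have "mind (insert x F) = (\<lambda>t. min ((t - x)\<^sup>2) (mind F t))"
    by (simp add: mind_insert fun_eq_iff)
  then show ?case
    using insert.IH by (simp add: continuous_on_min continuous_on_power continuous_on_diff)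
qed

lemma mind_tmap_image: "finite S \<Longrightarrow> S \<noteq> {} \<Longrightarrow> mind (tmap ` S) (tmap t) = mind S t / 9"
proof -
  assume *: "finite S" "S \<noteq> {}"
  have "(\<lambda>a. (tmap t - a)\<^sup>2) ` tmap ` S = (\<lambda>z. z / 9) ` (\<lambda>a. (t - a)\<^sup>2) ` S"
    unfolding image_image by (rule image_cong) (auto simp: tmap_def power2_eq_square field_simps)
  moreover have "Min ((\<lambda>z. z / 9) ` (\<lambda>a. (t - a)\<^sup>2) ` S) = Min ((\<lambda>a. (t - a)\<^sup>2) ` S) / 9"
    using * by (intro mono_Min_commute[symmetric]) (auto simp: mono_def)
  ultimately show ?thesis by (simp add: mind_def)
qed

definition dist_P :: "real set \<Rightarrow> real" where
  "dist_P S = (\<integral>t. mind S t \<partial>P)"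

definition dist_L :: "real set \<Rightarrow> real" where
  "dist_L S = (\<integral>t. mind S t \<partial>PL)"

definition dist_R :: "real set \<Rightarrow> real" where
  "dist_R S = (\<integral>t. mind S t \<partial>PR)"

lemma integrable_mind:
  assumes "finite S" "S \<noteq> {}"
  shows "integrable P (mind S)" "integrable PL (mind S)" "integrable PR (mind S)"
  using integrable_continuous_measures[OF continuous_on_mind[OF assms]] by auto

lemma distortion_eq:
  assumes "finite S" "S \<noteq> {}"
  shows "distortion S = ennreal (dist_P S)"
  unfolding distortion_def dist_P_def mind_def[symmetric]
  using assms by (intro nn_integral_eq_integral integrable_mind) (auto simp: mind_nonneg)

lemma dist_P_nonneg: "finite S \<Longrightarrow> S \<noteq> {} \<Longrightarrow> 0 \<le> dist_P S"
  unfolding dist_P_def by (simp add: mind_nonneg)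

lemma dist_P_eq:
  assumes "finite S" "S \<noteq> {}"
  shows "dist_P S = dist_L S + dist_R S"
  unfolding dist_P_def dist_L_def dist_R_def
  using assms by (intro integral_P_nonneg continuous_on_mind mind_nonneg)

lemma dist_R_tmap_image:
  assumes "finite S" "S \<noteq> {}"
  shows "dist_R (tmap ` S) = dist_P S / 18"
proof -
  have "dist_R (tmap ` S) = 1/2 * (\<integral>t. mind (tmap ` S) (tmap t) \<partial>P)"
    unfolding dist_R_def using assms by (intro integral_P_nonneg continuous_on_mind mind_nonneg) auto
  then show ?thesis
    using assms by (simp add: mind_tmap_image dist_P_def)
qed

lemma dist_mono:
  assumes "finite S" "R \<subseteq> S" "R \<noteq> {}"
  shows "dist_L S \<le> dist_L R" "dist_R S \<le> dist_R R"
proof -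
  have "finite R" "S \<noteq> {}" using assms finite_subset by auto
  then show "dist_L S \<le> dist_L R" "dist_R S \<le> dist_R R"
    unfolding dist_L_def dist_R_def
    using assms by (auto intro!: integral_mono integrable_mind mind_mono)
qed

lemma dist_P_Un_le:
  assumes "finite L" "L \<noteq> {}" "finite R" "R \<noteq> {}"
  shows "dist_P (L \<union> R) \<le> dist_L L + dist_R R"
  using assms dist_mono(1)[of "L \<union> R" L] dist_mono(2)[of "L \<union> R" R] by (simp add: dist_P_eq)

lemma dist_P_singleton: "dist_P {a} = 25/204 + (a - 1/2)\<^sup>2"
  by (simp add: dist_P_def integral_P_square)

lemma dist_R_singleton: "dist_R {5/6} = 25/204/18"
  by (simp add: dist_R_def integral_PR_square)

text \<open>
  Bumps give the lower bound for uniform quantization without ordering the points: the part of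
  the level \<open>h\<^sup>2\<close> that each point saves is at most the area of one parabola, and \<open>h = 1 / (6 r)\<close>
  makes the bound sharp for \<open>r\<close> midpoints.
\<close>

definition bump :: "real \<Rightarrow> real \<Rightarrow> real \<Rightarrow> real" where
  "bump h a t = max 0 (h\<^sup>2 - (t - a)\<^sup>2)"

lemma bump_nonneg [simp]: "0 \<le> bump h a t"
  by (simp add: bump_def)

lemma continuous_on_bump: "continuous_on UNIV (bump h a)"
  unfolding bump_def[abs_def] by (intro continuous_intros)

text \<open>The bump of the nearest point alone is at least the saving
  \<open>h\<^sup>2 - mind S t\<close>; the other bumps are nonnegative.\<close>

lemma mind_ge_bumps:
  assumes "finite S" "S \<noteq> {}"
  shows "h\<^sup>2 - (\<Sum>a\<in>S. bump h a t) \<le> mind S t"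
proof -
  obtain a where a: "a \<in> S" "mind S t = (t - a)\<^sup>2"
    using mind_attained[OF assms] by blast
  have "bump h a t \<le> (\<Sum>a\<in>S. bump h a t)"
    using assms a by (intro member_le_sum) auto
  then show ?thesis
    using a(2) by (simp add: bump_def max_def split: if_splits)
qed

lemma bump_eq:
  assumes "h > 0"
  shows "bump h a t = (if t \<in> {a - h..a + h} then h\<^sup>2 - (t - a)\<^sup>2 else 0)"
proof -
  have "t \<in> {a - h..a + h} \<longleftrightarrow> \<bar>t - a\<bar> \<le> \<bar>h\<bar>" using assms by auto
  also have "\<dots> \<longleftrightarrow> (t - a)\<^sup>2 \<le> h\<^sup>2" by (rule abs_le_square_iff)
  finally show ?thesis by (auto simp: bump_def)
qed

lemma set_integrable_parabola:
  "set_integrable lborel {p..q} (\<lambda>t. h\<^sup>2 - (t - a)\<^sup>2 :: real)"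
  by (intro borel_integrable_atLeastAtMost' continuous_intros)

lemma integral_parabola:
  fixes a h p q :: real
  assumes "p \<le> q"
  shows "(LINT t:{p..q}|lborel. h\<^sup>2 - (t - a)\<^sup>2) = h\<^sup>2 * (q - p) - ((q - a) ^ 3 - (p - a) ^ 3) / 3"
proof -
  have "(LINT t:{p..q}|lborel. h\<^sup>2 - (t - a)\<^sup>2) =
      (LINT t:{p..q}|lborel. h\<^sup>2) - (LINT t:{p..q}|lborel. (t - a)\<^sup>2)"
    by (intro set_integral_diff borel_integrable_atLeastAtMost' continuous_intros)
  moreover have "(LINT t:{p..q}|lborel. h\<^sup>2) = h\<^sup>2 * (q - p)"
    using assms by (simp add: set_lebesgue_integral_def mult.commute)
  ultimately show ?thesis
    using assms by (simp add: integral_square)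
qed

text \<open>\<open>{p..q}\<close> is the part of the support \<open>{a - h..a + h}\<close> that can
  meet \<open>{0..1/3}\<close>. The full support and its two halves are the cases used
  below.\<close>

lemma integral_PL_bump_le_parabola:
  assumes "h > 0" "p \<le> q" "\<And>t. t \<in> {0..1/3} \<Longrightarrow> t \<in> {a - h..a + h} \<Longrightarrow> t \<in> {p..q}"
    "p \<ge> a - h" "q \<le> a + h"
  shows "(\<integral>t. bump h a t \<partial>PL) \<le> 3/2 * (h\<^sup>2 * (q - p) - ((q - a) ^ 3 - (p - a) ^ 3) / 3)"
proof -
  have "(LINT t:{0..1/3}|lborel. bump h a t) \<le> (LINT t:{p..q}|lborel. h\<^sup>2 - (t - a)\<^sup>2)"
    unfolding set_lebesgue_integral_def
  proof (rule integral_mono)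
    show "integrable lborel (\<lambda>t. indicat_real {0..1/3} t *\<^sub>R bump h a t)"
      using borel_integrable_atLeastAtMost'[OF continuous_on_subset[OF continuous_on_bump]]
      by (simp add: set_integrable_def)
    show "integrable lborel (\<lambda>t. indicat_real {p..q} t *\<^sub>R (h\<^sup>2 - (t - a)\<^sup>2))"
      using set_integrable_parabola by (simp add: set_integrable_def)
    fix t
    have "0 \<le> h\<^sup>2 - (t - a)\<^sup>2" if "t \<in> {p..q}"
    proof -
      have "\<bar>t - a\<bar> \<le> \<bar>h\<bar>" using that assms by auto
      then show ?thesis by (simp add: abs_le_square_iff)
    qed
    then show "indicat_real {0..1/3} t *\<^sub>R bump h a t \<le> indicat_real {p..q} t *\<^sub>R (h\<^sup>2 - (t - a)\<^sup>2)"
      using assms(3)[of t] bump_eq[OF assms(1), of a t] by (auto simp: indicator_def)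
  qed
  then show ?thesis
    unfolding integral_PL[OF borel_measurable_continuous_onI[OF continuous_on_bump]]
      integral_parabola[OF assms(2)] by (rule mult_left_mono) simp
qed

text \<open>Density 3/2 times the area 4/3 * h^3 under the parabola.\<close>

lemma integral_PL_bump_le:
  assumes "h > 0"
  shows "(\<integral>t. bump h a t \<partial>PL) \<le> 2 * h ^ 3"
  using integral_PL_bump_le_parabola[of h "a - h" "a + h" a] assms
  by (simp add: power2_eq_square power3_eq_cube)

text \<open>From outside the interval at most one half of the parabola reaches it. This loss is the
  source of strictness in \<open>dist_L_lower_strict\<close>.\<close>

lemma integral_PL_bump_outside:
  assumes "h > 0" "a \<notin> {0..1/3}"
  shows "(\<integral>t. bump h a t \<partial>PL) \<le> h ^ 3"
proof (cases "a < 0")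
  case True
  then show ?thesis
    using integral_PL_bump_le_parabola[of h a "a + h" a] assms
    by (simp add: power2_eq_square power3_eq_cube)
next
  case False
  then show ?thesis
    using integral_PL_bump_le_parabola[of h "a - h" a a] assms
    by (simp add: power2_eq_square power3_eq_cube)
qed

lemma integral_PL_bump_inside:
  assumes "h > 0" "0 \<le> a - h" "a + h \<le> 1/3"
  shows "(\<integral>t. bump h a t \<partial>PL) = 2 * h ^ 3"
proof -
  have "bump h a \<in> borel_measurable borel"
    by (rule borel_measurable_continuous_onI[OF continuous_on_bump])
  moreover have "(LINT t:{0..1/3}|lborel. bump h a t) = (LINT t:{a - h..a + h}|lborel. h\<^sup>2 - (t - a)\<^sup>2)"
    unfolding set_lebesgue_integral_def using assms
    by (intro Bochner_Integration.integral_cong) (auto simp: bump_eq indicator_def)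
  ultimately show ?thesis
    using assms by (simp add: integral_PL integral_parabola) (simp add: power2_eq_square power3_eq_cube)
qed

text \<open>Serves functions \<open>g\<close> that dominate \<open>mind L\<close> only off
  \<open>X\<close>, where \<open>X\<close> will be the cell of the straddling point and
  \<open>L\<close> the points left of it. On \<open>X\<close> the level \<open>h\<^sup>2\<close> of
  the bump bound is lowered to \<open>c\<close>, which costs \<open>h\<^sup>2 - c\<close> per unit
  of mass. The constant 1/36 is \<open>h\<^sup>2\<close> for a single point, so the charge does not
  depend on \<open>card L\<close>. What remains of the level is h^2/2 - h^2/3 = h^2/6.\<close>

lemma integral_PL_lower:
  assumes g: "integrable PL g" and X [measurable]: "X \<in> sets borel"
    and L: "finite L" "L \<noteq> {}"
    and out: "\<And>t. t \<in> {0..1/3} \<Longrightarrow> t \<notin> X \<Longrightarrow> mind L t \<le> g t"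
    and ins: "\<And>t. t \<in> {0..1/3} \<Longrightarrow> t \<in> X \<Longrightarrow> c \<le> g t"
  shows "1 / (216 * real (card L) ^ 2) + measure PL X * (c - 1/36) \<le> integral\<^sup>L PL g"
proof -
  define r where "r = card L"
  have r: "r \<ge> 1" using L by (simp add: r_def Suc_leI card_gt_0_iff)
  define h where "h = 1 / (6 * real r)"
  have h: "h > 0" "real r * h = 1/6" using r by (auto simp: h_def)
  have "h \<le> 1/6" using r by (simp add: h_def field_simps)
  then have h2: "h\<^sup>2 \<le> 1/36"
    using power_mono[of h "1/6" 2] h by (simp add: power2_eq_square)
  let ?G = "\<lambda>t. h\<^sup>2 - (\<Sum>a\<in>L. bump h a t) + indicat_real X t * (c - h\<^sup>2)"
  have ib: "integrable PL (bump h a)" for a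
    by (rule integrable_continuous_measures[OF continuous_on_bump])
  have iX: "integrable PL (indicat_real X)"
    by (rule integrable_real_indicator) (auto simp: less_top[symmetric])
  have "integral\<^sup>L PL ?G = h\<^sup>2 / 2 - (\<Sum>a\<in>L. \<integral>t. bump h a t \<partial>PL) + measure PL X * (c - h\<^sup>2)"
    using ib iX by (simp add: integral_sum)
  moreover have "(\<Sum>a\<in>L. \<integral>t. bump h a t \<partial>PL) \<le> real r * (2 * h ^ 3)"
    unfolding r_def using integral_PL_bump_le[OF h(1)] by (intro sum_bounded_above)
  moreover have "real r * (2 * h ^ 3) = h\<^sup>2 / 3"
    using arg_cong[OF h(2), of "\<lambda>z. 2 * z * h\<^sup>2"] by (simp add: power2_eq_square power3_eq_cube)
  moreover have "measure PL X * (c - 1/36) \<le> measure PL X * (c - h\<^sup>2)"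
    using h2 by (intro mult_left_mono) auto
  moreover have "integral\<^sup>L PL ?G \<le> integral\<^sup>L PL g"
  proof (rule integral_mono_AE[OF _ g])
    show "integrable PL ?G" using ib iX by simp
    show "AE t in PL. ?G t \<le> g t"
      using AE_PL
    proof eventually_elim
      case (elim t)
      have "0 \<le> (\<Sum>a\<in>L. bump h a t)" by (simp add: sum_nonneg)
      then show ?case
        using mind_ge_bumps[OF L, of h t] out[OF elim] ins[OF elim] by (cases "t \<in> X") auto
    qed
  qed
  moreover have "h\<^sup>2 / 6 = 1 / (216 * real (card L) ^ 2)"
    using r by (simp add: h_def r_def power2_eq_square field_simps)
  ultimately show ?thesis by linarith
qed

lemma dist_L_lower:
  assumes "finite L" "L \<noteq> {}"
  shows "1 / (216 * real (card L) ^ 2) \<le> dist_L L"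
  using integral_PL_lower[of "mind L" "{}" L 0] integrable_mind[OF assms] assms
  by (simp add: dist_L_def)

text \<open>A point outside \<open>{0..1/3}\<close> wastes at least half of its bump. This later
  forces the left part of an optimal set into \<open>J 1\<close>.\<close>

lemma dist_L_lower_strict:
  assumes L: "finite L" "L \<noteq> {}" and "\<not> L \<subseteq> {0..1/3}"
  shows "1 / (216 * real (card L) ^ 2) < dist_L L"
proof -
  obtain b where b: "b \<in> L" "b \<notin> {0..1/3}" using assms by blast
  define r where "r = card L"
  have r: "r \<ge> 1" using L by (simp add: r_def Suc_leI card_gt_0_iff)
  define h where "h = 1 / (6 * real r)"
  have h: "h > 0" "real r * h = 1/6" using r by (auto simp: h_def)
  have ib: "integrable PL (bump h a)" for a
    by (rule integrable_continuous_measures[OF continuous_on_bump])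
  have "h\<^sup>2 / 2 - (\<Sum>a\<in>L. \<integral>t. bump h a t \<partial>PL) = (\<integral>t. h\<^sup>2 - (\<Sum>a\<in>L. bump h a t) \<partial>PL)"
    using ib by (simp add: integral_sum)
  also have "\<dots> \<le> dist_L L"
    unfolding dist_L_def using L ib
    by (intro integral_mono integrable_mind mind_ge_bumps) auto
  finally have "h\<^sup>2 / 2 - (\<Sum>a\<in>L. \<integral>t. bump h a t \<partial>PL) \<le> dist_L L" .
  moreover have "(\<Sum>a\<in>L. \<integral>t. bump h a t \<partial>PL) < (\<Sum>a\<in>L. 2 * h ^ 3)"
  proof (rule sum_strict_mono_ex1[OF L(1)])
    show "\<forall>a\<in>L. (\<integral>t. bump h a t \<partial>PL) \<le> 2 * h ^ 3"
      using integral_PL_bump_le[OF h(1)] by blast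
    have "(\<integral>t. bump h b t \<partial>PL) < 2 * h ^ 3"
      using integral_PL_bump_outside[OF h(1) b(2)] zero_less_power[OF h(1), of 3] by linarith
    then show "\<exists>a\<in>L. (\<integral>t. bump h a t \<partial>PL) < 2 * h ^ 3"
      using b(1) by blast
  qed
  moreover have "(\<Sum>a\<in>L. 2 * h ^ 3) = h\<^sup>2 / 3"
    using arg_cong[OF h(2), of "\<lambda>z. 2 * z * h\<^sup>2"] by (simp add: r_def power2_eq_square power3_eq_cube)
  moreover have "h\<^sup>2 / 6 = 1 / (216 * real (card L) ^ 2)"
    using r by (simp add: h_def r_def power2_eq_square field_simps)
  ultimately show ?thesis by linarith
qed

section \<open>Midpoint sets attain the bound on \<open>J 1\<close>\<close>

definition unif :: "nat \<Rightarrow> real set" where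
  "unif r = (\<lambda>i. (2 * real i - 1) / (2 * real r) * (1/3)) ` {1..r}"

lemma finite_unif [simp]: "finite (unif r)"
  by (simp add: unif_def)

lemma unif_nonempty [simp]: "r \<ge> 1 \<Longrightarrow> unif r \<noteq> {}"
  by (simp add: unif_def)

lemma inj_on_unif: "inj_on (\<lambda>i. (2 * real i - 1) / (2 * real r) * (1/3)) {1..r}"
  by (auto simp: inj_on_def field_simps)

lemma card_unif [simp]: "card (unif r) = r"
  unfolding unif_def card_image[OF inj_on_unif] by simp

lemma unif_subset: "unif r \<subseteq> {0..1/3}"
  by (auto simp: unif_def field_simps)

text \<open>The bumps of radius \<open>h\<close> around the midpoints tile \<open>{0..1/3}\<close>,
  so at each \<open>t\<close> a single bump accounts for the whole saving and the estimate of
  \<open>mind_ge_bumps\<close> becomes sharp.\<close>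

lemma dist_L_unif:
  assumes r: "r \<ge> 1"
  shows "dist_L (unif r) \<le> 1 / (216 * real r ^ 2)"
proof -
  define h where "h = 1 / (6 * real r)"
  have h: "h > 0" "real r * h = 1/6" using r by (auto simp: h_def)
  define c where "c = (\<lambda>i::nat. (2 * real i - 1) * h)"
  have u: "unif r = c ` {1..r}"
    using r by (auto simp: unif_def c_def h_def field_simps)
  have ib: "integrable PL (bump h a)" for a
    by (rule integrable_continuous_measures[OF continuous_on_bump])
  have "dist_L (unif r) \<le> (\<integral>t. h\<^sup>2 - (\<Sum>i\<in>{1..r}. bump h (c i) t) \<partial>PL)"
    unfolding dist_L_def
  proof (rule integral_mono_AE)
    show "integrable PL (mind (unif r))" using r by (intro integrable_mind) auto
    show "integrable PL (\<lambda>t. h\<^sup>2 - (\<Sum>i\<in>{1..r}. bump h (c i) t))" using ib by simp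
    show "AE t in PL. mind (unif r) t \<le> h\<^sup>2 - (\<Sum>i\<in>{1..r}. bump h (c i) t)"
      using AE_PL
    proof eventually_elim
      case (elim t)
      obtain i where i: "i \<in> {1..r}" "2 * (real i - 1) * h \<le> t" "t \<le> 2 * real i * h"
      \<comment> \<open>\<open>i\<close> is the index of the cell containing \<open>t\<close>. The
        ceiling formula gives 0 at \<open>t = 0\<close>, which belongs to cell 1.\<close>
      proof (cases "t = 0")
        case True
        then show ?thesis using that[of 1] r h by auto
      next
        case False
        define i where "i = nat \<lceil>t / (2 * h)\<rceil>"
        have pos: "t / (2 * h) > 0" using False elim h by auto
        have "t / (2 * h) \<le> real r" using elim h by (simp add: field_simps)
        then have "i \<in> {1..r}" using pos unfolding i_def by (auto simp: ceiling_le_iff) linarith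
        moreover have "real i - 1 < t / (2 * h)" "t / (2 * h) \<le> real i"
          using pos unfolding i_def by linarith+
        ultimately show ?thesis using h by (intro that[of i]) (auto simp: field_simps)
      qed
      \<comment> \<open>Midpoints are at least \<open>2 * h\<close> apart, so supports of different
        bumps share at most an endpoint, where the bumps vanish.\<close>
      have *: "bump h (c j) t = 0" if "j \<noteq> i" for j
      proof (cases "j < i")
        case True
        then have "real j + 1 \<le> real i" by linarith
        then have "real j * h + h \<le> real i * h"
          using mult_right_mono[of "real j + 1" "real i" h] h by (simp add: algebra_simps)
        then have "c j + h \<le> t" using i by (simp add: c_def algebra_simps)
        then show ?thesis using h(1) by (auto simp: bump_def intro!: power_mono)
      next
        case False
        then have "real i + 1 \<le> real j" using that by linarith
        then have "real i * h + h \<le> real j * h"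
          using mult_right_mono[of "real i + 1" "real j" h] h by (simp add: algebra_simps)
        then have "t \<le> c j - h" using i by (simp add: c_def algebra_simps)
        then have "h\<^sup>2 \<le> (c j - t)\<^sup>2" using h(1) by (intro power_mono) auto
        then show ?thesis by (simp add: bump_def power2_commute)
      qed
      have "(\<Sum>j\<in>{1..r}. bump h (c j) t) = bump h (c i) t"
        using i(1) * by (subst sum.remove[of _ i]) (auto intro!: sum.neutral)
      also have "\<dots> = h\<^sup>2 - (t - c i)\<^sup>2"
        using i h by (subst bump_eq) (auto simp: c_def algebra_simps)
      finally show ?case
        using i(1) mind_le[of "unif r" "c i" t] by (simp add: u)
    qed
  qed
  also have "\<dots> = h\<^sup>2 / 2 - (\<Sum>i\<in>{1..r}. \<integral>t. bump h (c i) t \<partial>PL)"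
    using ib by (simp add: integral_sum)
  also have "(\<Sum>i\<in>{1..r}. \<integral>t. bump h (c i) t \<partial>PL) = (\<Sum>i\<in>{1..r}. 2 * h ^ 3)"
  proof (intro sum.cong refl integral_PL_bump_inside h)
    fix i assume i: "i \<in> {1..r}"
    then have "1 * h \<le> real i * h" "real i * h \<le> real r * h"
      using h(1) by (intro mult_right_mono; simp)+
    then show "0 \<le> c i - h" "c i + h \<le> 1/3"
      unfolding c_def left_diff_distrib using h(2) by linarith+
  qed
  also have "\<dots> = h\<^sup>2 / 3"
    using arg_cong[OF h(2), of "\<lambda>z. 2 * z * h\<^sup>2"] by (simp add: power2_eq_square power3_eq_cube)
  also have "h\<^sup>2 / 2 - h\<^sup>2 / 3 = 1 / (216 * real r ^ 2)"
    using r by (simp add: h_def power2_eq_square field_simps)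
  finally show ?thesis .
qed

section \<open>Splitting across the gap\<close>

text \<open>The difference of the two squared distances is affine in \<open>t\<close>; its sign at
  \<open>p\<close> persists to the left.\<close>

lemma nearer_left:
  fixes a b p t :: real
  assumes "(p - b)\<^sup>2 \<le> (p - a)\<^sup>2" "b < a" "t \<le> p"
  shows "(t - b)\<^sup>2 \<le> (t - a)\<^sup>2"
proof -
  have eq: "(t - a)\<^sup>2 - (t - b)\<^sup>2 = (a - b) * (a + b - 2 * t)" for t
    by (simp add: power2_eq_square algebra_simps)
  have "0 \<le> (a - b) * (a + b - 2 * p)" using assms(1) eq[of p] by linarith
  also have "\<dots> \<le> (a - b) * (a + b - 2 * t)"
    using assms by (intro mult_left_mono) auto
  finally show ?thesis using eq[of t] by linarith
qed

lemma nearer_right: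
  fixes a b p t :: real
  assumes "(p - b)\<^sup>2 \<le> (p - a)\<^sup>2" "a < b" "p \<le> t"
  shows "(t - b)\<^sup>2 \<le> (t - a)\<^sup>2"
  using nearer_left[of "-p" "-b" "-a" "-t"] assms by (simp add: power2_commute)

text \<open>By \<open>nearer_left\<close> every point right of \<open>b\<close> is dominated by
  \<open>b\<close> at all \<open>t \<le> p\<close>. With \<open>p = 1/3\<close> this isolates the
  points that serve \<open>J 1\<close>.\<close>

lemma mind_left:
  assumes "finite S" "b \<in> S" "mind S p = (p - b)\<^sup>2" "t \<le> p"
  shows "mind S t = mind {a \<in> S. a \<le> b} t"
proof (rule antisym)
  show "mind S t \<le> mind {a \<in> S. a \<le> b} t"
    using assms(1,2) by (intro mind_mono) blast+
  show "mind {a \<in> S. a \<le> b} t \<le> mind S t"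
  proof (rule mind_ge)
    fix a assume a: "a \<in> S"
    show "mind {a \<in> S. a \<le> b} t \<le> (t - a)\<^sup>2"
    proof (cases "a \<le> b")
      case False
      then have "(t - b)\<^sup>2 \<le> (t - a)\<^sup>2"
        using nearer_left[of p b a t] assms mind_le[of S a p] a by simp
      moreover have "mind {a \<in> S. a \<le> b} t \<le> (t - b)\<^sup>2"
        using assms(1,2) by (intro mind_le) simp_all
      ultimately show ?thesis by linarith
    qed (use a assms(1) in \<open>simp add: mind_le\<close>)
  qed (use assms(1,2) in auto)
qed

lemma mind_right:
  assumes "finite S" "b \<in> S" "mind S p = (p - b)\<^sup>2" "p \<le> t"
  shows "mind S t = mind {a \<in> S. b \<le> a} t"
proof (rule antisym)
  show "mind S t \<le> mind {a \<in> S. b \<le> a} t"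
    using assms(1,2) by (intro mind_mono) blast+
  show "mind {a \<in> S. b \<le> a} t \<le> mind S t"
  proof (rule mind_ge)
    fix a assume a: "a \<in> S"
    show "mind {a \<in> S. b \<le> a} t \<le> (t - a)\<^sup>2"
    proof (cases "b \<le> a")
      case False
      then have "(t - b)\<^sup>2 \<le> (t - a)\<^sup>2"
        using nearer_right[of p b a t] assms mind_le[of S a p] a by simp
      moreover have "mind {a \<in> S. b \<le> a} t \<le> (t - b)\<^sup>2"
        using assms(1,2) by (intro mind_le) simp_all
      ultimately show ?thesis by linarith
    qed (use a assms(1) in \<open>simp add: mind_le\<close>)
  qed (use assms(1,2) in auto)
qed

text \<open>The constant \<open>c\<close> may have either sign: it records a gain on
  \<open>Z\<close> when the straddling point is moved, and a bounded loss when it is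
  removed.\<close>

lemma (in finite_measure) integral_gain_on_set:
  fixes f g :: "'a \<Rightarrow> real"
  assumes "integrable M f" "integrable M g" "Z \<in> sets M"
    and AE: "AE t in M. t \<in> A"
    and "\<And>t. t \<in> A \<Longrightarrow> t \<in> Z \<Longrightarrow> f t + c \<le> g t" "\<And>t. t \<in> A \<Longrightarrow> t \<notin> Z \<Longrightarrow> f t \<le> g t"
  shows "integral\<^sup>L M f + measure M Z * c \<le> integral\<^sup>L M g"
proof -
  have i: "integrable M (indicat_real Z)"
    using assms(3) by (intro integrable_real_indicator) (auto simp: less_top[symmetric])
  have "integral\<^sup>L M f + measure M Z * c = (\<integral>t. f t + indicat_real Z t * c \<partial>M)"
    using assms i by (simp add: sets.Int_space_eq1)
  also have "\<dots> \<le> integral\<^sup>L M g"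
  proof (rule integral_mono_AE)
    show "AE t in M. f t + indicat_real Z t * c \<le> g t"
      using AE by eventually_elim (use assms(5,6) in \<open>auto simp: indicator_def\<close>)
  qed (use assms i in auto)
  finally show ?thesis .
qed

lemma dist_cong:
  assumes "finite S" "S \<noteq> {}" "finite R" "R \<noteq> {}"
  shows "(\<And>t. t \<in> {0..1/3} \<Longrightarrow> mind S t = mind R t) \<Longrightarrow> dist_L S = dist_L R"
    and "(\<And>t. t \<in> {2/3..1} \<Longrightarrow> mind S t = mind R t) \<Longrightarrow> dist_R S = dist_R R"
proof -
  have m: "mind S \<in> borel_measurable borel" "mind R \<in> borel_measurable borel"
    using assms by (simp_all add: borel_measurable_continuous_onI continuous_on_mind)
  show "dist_L S = dist_L R" if "\<And>t. t \<in> {0..1/3} \<Longrightarrow> mind S t = mind R t"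
    unfolding dist_L_def
    by (rule integral_cong_AE, use m in simp, use m in simp)
       (rule eventually_mono[OF AE_PL], rule that)
  show "dist_R S = dist_R R" if "\<And>t. t \<in> {2/3..1} \<Longrightarrow> mind S t = mind R t"
    unfolding dist_R_def
    by (rule integral_cong_AE, use m in simp, use m in simp)
       (rule eventually_mono[OF AE_PR], rule that)
qed

section \<open>The point that straddles the gap\<close>

text \<open>Here \<open>L\<close> and \<open>R\<close> consist of points of \<open>S\<close>, so
  that an optimal set can be recovered as their union, and equality of errors is allowed. In
  \<open>improvable\<close> the points may be new but the drop is strict, which contradicts
  optimality.\<close>

definition splittable :: "real set \<Rightarrow> bool" where
  "splittable S \<longleftrightarrow> (\<exists>L R. L \<noteq> {} \<and> R \<noteq> {} \<and> L \<subseteq> S \<and> R \<subseteq> S \<and> L \<inter> R = {} \<and>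
     dist_L L + dist_R R \<le> dist_P S)"

definition improvable :: "real set \<Rightarrow> bool" where
  "improvable S \<longleftrightarrow> (\<exists>L R. finite L \<and> finite R \<and> L \<noteq> {} \<and> R \<noteq> {} \<and>
     card L + card R \<le> card S \<and> dist_L L + dist_R R < dist_P S)"

lemma splittableI:
  "L \<noteq> {} \<Longrightarrow> R \<noteq> {} \<Longrightarrow> L \<subseteq> S \<Longrightarrow> R \<subseteq> S \<Longrightarrow> L \<inter> R = {} \<Longrightarrow>
     dist_L L + dist_R R \<le> dist_P S \<Longrightarrow> splittable S"
  unfolding splittable_def by blast

lemma improvableI:
  "finite L \<Longrightarrow> finite R \<Longrightarrow> L \<noteq> {} \<Longrightarrow> R \<noteq> {} \<Longrightarrow>
     card L + card R \<le> card S \<Longrightarrow> dist_L L + dist_R R < dist_P S \<Longrightarrow> improvable S"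
  unfolding improvable_def by blast

text \<open>If all points meant for the right side lie beyond 11/12, their error on
  \<open>J 2 = {2/3..7/9}\<close> alone exceeds the error of the single point 5/6. Pulled back by
  \<open>tmap\<close>, the integral over \<open>J 2\<close> becomes one over \<open>J 1\<close>,
  where \<open>integral_PL_square\<close> evaluates it.\<close>

lemma integral_PR_parabola_lower:
  "25/204/18 < (\<integral>t. indicat_real {2/3..7/9} t * (t - 11/12)\<^sup>2 \<partial>PR)"
proof -
  let ?f = "\<lambda>t::real. indicat_real {2/3..7/9} t * (t - 11/12)\<^sup>2"
  let ?q = "\<lambda>t::real. (t - 11/12)\<^sup>2"
  let ?g = "\<lambda>t::real. indicat_real {0..1/3} t * (1/9 * (t - 3/4)\<^sup>2)"
  have m [measurable]: "?f \<in> borel_measurable borel" by measurable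
  have "integrable PR ?f"
    by (rule Bochner_Integration.integrable_bound[OF integrable_continuous_measures(3)[of ?q]])
       (auto intro!: continuous_intros AE_I2 simp: indicator_def)
  then have 1: "ennreal (\<integral>t. ?f t \<partial>PR) = (\<integral>\<^sup>+t. ennreal (?f t) \<partial>PR)"
    by (subst nn_integral_eq_integral) auto
  have "integrable PL ?g"
    by (rule Bochner_Integration.integrable_bound[OF integrable_continuous_measures(2)[of "\<lambda>t. 1/9 * (t - 3/4)\<^sup>2"]])
       (auto intro!: continuous_intros AE_I2 simp: indicator_def)
  then have 2: "ennreal (\<integral>t. ?g t \<partial>PL) = (\<integral>\<^sup>+t. ennreal (?g t) \<partial>PL)"
    by (subst nn_integral_eq_integral) auto
  have fg: "?f (tmap t) = ?g t" for t
    by (auto simp: indicator_def tmap_def field_simps power2_eq_square)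
  have "(\<integral>\<^sup>+t. ennreal (?f t) \<partial>PR) = ennreal (1/2) * (\<integral>\<^sup>+t. ennreal (?g t) \<partial>P)"
    by (subst nn_integral_PR) (simp_all add: fg)
  also have "\<dots> \<ge> ennreal (1/2) * (\<integral>\<^sup>+t. ennreal (?g t) \<partial>PL)"
    by (subst nn_integral_P) (auto intro!: mult_left_mono)
  also have "ennreal (1/2) * (\<integral>\<^sup>+t. ennreal (?g t) \<partial>PL) = ennreal (1/2 * (\<integral>t. ?g t \<partial>PL))"
    unfolding 2[symmetric] by (subst ennreal_mult) auto
  finally have "1/2 * (\<integral>t. ?g t \<partial>PL) \<le> (\<integral>t. ?f t \<partial>PR)"
    unfolding 1[symmetric] by (subst (asm) ennreal_le_iff) auto
  moreover have "(\<integral>t. ?g t \<partial>PL) = (\<integral>t. 1/9 * (t - 3/4)\<^sup>2 \<partial>PL)"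
    by (rule integral_cong_AE, simp, simp, rule eventually_mono[OF AE_PL]) simp
  moreover have "\<dots> = 1/9 * (1/216 + 1/2 * (3/4 - 1/6)\<^sup>2)"
    by (subst integral_mult_right_zero) (simp add: integral_PL_square)
  ultimately show ?thesis by (simp add: power2_eq_square)
qed

lemma two_point_bound:
  fixes b :: real
  defines "e \<equiv> max 0 (b - 1/3)" and "f \<equiv> max 0 (2/3 - b)"
  shows "e\<^sup>2 + f\<^sup>2 / 2 \<ge> 1/27" "2 * e\<^sup>2 + f\<^sup>2 \<ge> 2/27"
proof -
  have "e + f \<ge> 1/3" unfolding e_def f_def by linarith
  have "(e + f)\<^sup>2 \<ge> (1/3)\<^sup>2" using \<open>e + f \<ge> 1/3\<close> by (intro power_mono) auto
  \<comment> \<open>The defect is explicit: e^2 + f^2/2 = (e + f)^2/3 + (2e - f)^2/6.\<close>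
  moreover have "(2 * e - f)\<^sup>2 \<ge> 0" by simp
  ultimately show "e\<^sup>2 + f\<^sup>2 / 2 \<ge> 1/27" "2 * e\<^sup>2 + f\<^sup>2 \<ge> 2/27"
    by (simp_all add: power2_eq_square algebra_simps)
qed

lemma straddle_cases:
  assumes fin: "finite S" and card: "card S \<ge> 2" and b: "b \<in> S"
    and near: "mind S (1/3) = (1/3 - b)\<^sup>2" "mind S (2/3) = (2/3 - b)\<^sup>2"
  shows "splittable S \<or> improvable S"
proof -
  define L0 where "L0 = {a \<in> S. a < b}"
  define R0 where "R0 = {a \<in> S. b < a}"
  have S: "S = insert b (L0 \<union> R0)" "L0 \<inter> R0 = {}" "b \<notin> L0" "b \<notin> R0" "finite L0" "finite R0" "S \<noteq> {}"
    using fin b by (auto simp: L0_def R0_def)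
  have cardS: "card S = Suc (card L0 + card R0)"
    using S by (subst S(1)) (simp add: card_Un_disjoint)
  have S_left: "{a \<in> S. a \<le> b} = insert b L0" and S_right: "{a \<in> S. b \<le> a} = insert b R0"
    using b by (auto simp: L0_def R0_def)
  have left: "mind S t = mind (insert b L0) t" if "t \<in> {0..1/3}" for t
    using mind_left[OF fin b near(1), of t] that S_left by simp
  have right: "mind S t = mind (insert b R0) t" if "t \<in> {2/3..1}" for t
    using mind_right[OF fin b near(2), of t] that S_right by simp
  \<comment> \<open>the Voronoi cell of the straddling point \<open>b\<close>; its masses on the two sides decide which side gets \<open>b\<close>\<close>
  define Z where "Z = {t. (t - b)\<^sup>2 \<le> mind S t}"
  have Z [measurable]: "Z \<in> sets borel"
    unfolding Z_def using S fin
    by (intro borel_closed closed_Collect_le continuous_intros continuous_on_mind) auto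
  have inZ: "mind S t = (t - b)\<^sup>2" if "t \<in> Z" for t
    using that mind_le[OF fin b, of t] by (simp add: Z_def)
  have outL: "L0 \<noteq> {}" "mind L0 t = mind S t" if t: "t \<in> {0..1/3}" "t \<notin> Z" for t
  proof -
    obtain a where a: "a \<in> insert b L0" "mind (insert b L0) t = (t - a)\<^sup>2"
      using mind_attained[of "insert b L0" t] S by auto
    then have "a \<in> L0" using left[OF t(1)] t(2) by (auto simp: Z_def)
    then show "L0 \<noteq> {}" by blast
    then have "mind (insert b L0) t \<le> mind L0 t" using S by (intro mind_mono) auto
    moreover have "mind L0 t \<le> (t - a)\<^sup>2" using S \<open>a \<in> L0\<close> by (intro mind_le)
    ultimately show "mind L0 t = mind S t" using a(2) left[OF t(1)] by linarith
  qed
  have outR: "R0 \<noteq> {}" "mind R0 t = mind S t" if t: "t \<in> {2/3..1}" "t \<notin> Z" for t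
  proof -
    obtain a where a: "a \<in> insert b R0" "mind (insert b R0) t = (t - a)\<^sup>2"
      using mind_attained[of "insert b R0" t] S by auto
    then have "a \<in> R0" using right[OF t(1)] t(2) by (auto simp: Z_def)
    then show "R0 \<noteq> {}" by blast
    then have "mind (insert b R0) t \<le> mind R0 t" using S by (intro mind_mono) auto
    moreover have "mind R0 t \<le> (t - a)\<^sup>2" using S \<open>a \<in> R0\<close> by (intro mind_le)
    ultimately show "mind R0 t = mind S t" using a(2) right[OF t(1)] by linarith
  qed
  define m1 where "m1 = measure PL Z"
  define m2 where "m2 = measure PR Z"
  have m: "0 \<le> m1" "0 \<le> m2" "m1 \<le> 1/2"
    using PL.bounded_measure[of Z] by (auto simp: m1_def m2_def)
  have m1_full: "m1 = 1/2" if "L0 = {}"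
  proof -
    have "AE t in PL. t \<in> Z \<longleftrightarrow> t \<in> UNIV" by (rule eventually_mono[OF AE_PL]) (use outL(1) that in blast)
    then have "measure PL Z = measure PL UNIV" by (intro measure_eq_AE) auto
    then show ?thesis by (simp add: m1_def)
  qed
  have m2_full: "m2 = 1/2" if "R0 = {}"
  proof -
    have "AE t in PR. t \<in> Z \<longleftrightarrow> t \<in> UNIV" by (rule eventually_mono[OF AE_PR]) (use outR(1) that in blast)
    then have "measure PR Z = measure PR UNIV" by (intro measure_eq_AE) auto
    then show ?thesis by (simp add: m2_def)
  qed
  define e where "e = max 0 (b - 1/3)"
  define f where "f = max 0 (2/3 - b)"
  note ef = two_point_bound[of b, folded e_def f_def]
  \<comment> \<open>Projecting \<open>b\<close> onto \<open>{..1/3}\<close> makes an obtuse angle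
    with every \<open>t\<close> on the left, so at least \<open>e\<^sup>2\<close> is saved there;
    \<open>f_le\<close> is the mirror image.\<close>
  have e_le: "(t - min b (1/3))\<^sup>2 + e\<^sup>2 \<le> (t - b)\<^sup>2" if "t \<in> {0..1/3}" for t
  proof (cases "b \<ge> 1/3")
    case True
    have "(t - b)\<^sup>2 - (t - 1/3)\<^sup>2 - (b - 1/3)\<^sup>2 = 2 * ((1/3 - t) * (b - 1/3))"
      by (simp add: power2_eq_square algebra_simps)
    moreover have "\<dots> \<ge> 0" using that True by auto
    ultimately have "(t - 1/3)\<^sup>2 + (b - 1/3)\<^sup>2 \<le> (t - b)\<^sup>2" by linarith
    then show ?thesis using True by (simp add: e_def)
  qed (simp add: e_def)
  have f_le: "(t - max b (2/3))\<^sup>2 + f\<^sup>2 \<le> (t - b)\<^sup>2" if "t \<in> {2/3..1}" for t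
  proof (cases "b \<le> 2/3")
    case True
    have "(t - b)\<^sup>2 - (t - 2/3)\<^sup>2 - (2/3 - b)\<^sup>2 = 2 * ((t - 2/3) * (2/3 - b))"
      by (simp add: power2_eq_square algebra_simps)
    moreover have "\<dots> \<ge> 0" using that True by auto
    ultimately have "(t - 2/3)\<^sup>2 + (2/3 - b)\<^sup>2 \<le> (t - b)\<^sup>2" by linarith
    then show ?thesis using True by (simp add: f_def)
  qed (simp add: f_def)
  have e_le': "e\<^sup>2 \<le> (t - b)\<^sup>2" if "t \<in> {0..1/3}" for t
    using e_le[OF that] zero_le_power2[of "t - min b (1/3)"] by linarith
  have f_le': "f\<^sup>2 \<le> (t - b)\<^sup>2" if "t \<in> {2/3..1}" for t
    using f_le[OF that] zero_le_power2[of "t - max b (2/3)"] by linarith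
  note iS = integrable_mind[OF fin \<open>S \<noteq> {}\<close>]
  have S_eq: "dist_P S = dist_L S + dist_R S" by (rule dist_P_eq[OF fin \<open>S \<noteq> {}\<close>])
  consider (A) "L0 \<noteq> {}" "m1 \<le> 2 * m2" | (B) "2 * m2 < m1" | (C) "L0 = {}" "m1 \<le> 2 * m2"
    by linarith
  then show ?thesis
  proof cases
    case A
    show ?thesis
    proof (cases "m1 = 0")
      case True
      obtain a where a: "a \<in> L0" using A by blast
      have "dist_L L0 + m1 * (- (1 + \<bar>a\<bar>)\<^sup>2) \<le> dist_L S"
        unfolding dist_L_def m1_def
      proof (rule PL.integral_gain_on_set[OF _ _ _ AE_PL])
        fix t :: real assume t: "t \<in> {0..1/3}"
        have "mind L0 t \<le> (t - a)\<^sup>2" using a S by (intro mind_le)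
        also have "\<dots> \<le> (1 + \<bar>a\<bar>)\<^sup>2" using t by (intro abs_le_square_iff[THEN iffD1]) auto
        finally show "mind L0 t + - (1 + \<bar>a\<bar>)\<^sup>2 \<le> mind S t"
          using mind_nonneg[OF fin \<open>S \<noteq> {}\<close>, of t] by linarith
        show "t \<notin> Z \<Longrightarrow> mind L0 t \<le> mind S t" using outL t by simp
      qed (use iS A S in \<open>auto intro!: integrable_mind\<close>)
      moreover have "dist_R (insert b R0) = dist_R S"
        using S(5,6,7) fin right by (intro dist_cong(2)) simp_all
      ultimately have "splittable S"
        using A S S_eq True by (intro splittableI[of L0 "insert b R0"]) auto
      then show ?thesis ..
    next
      case False
      \<comment> \<open>The left part will become a uniform set of \<open>card L0\<close> points; on
        the cell of \<open>b\<close> the old integrand was at least \<open>e\<^sup>2\<close>, which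
        reduces the charge 1/36.\<close>
      have "1 / (216 * real (card L0) ^ 2) + m1 * (e\<^sup>2 - 1/36) \<le> dist_L S"
        unfolding dist_L_def m1_def using iS A S outL inZ e_le'
        by (intro integral_PL_lower) auto
      moreover have "dist_R (insert (max b (2/3)) R0) + m2 * f\<^sup>2 \<le> dist_R S"
        unfolding dist_R_def m2_def
      proof (rule PR.integral_gain_on_set[OF _ _ _ AE_PR])
        fix t :: real assume t: "t \<in> {2/3..1}"
        show "mind (insert (max b (2/3)) R0) t + f\<^sup>2 \<le> mind S t" if "t \<in> Z"
          using inZ[OF that] f_le[OF t] mind_le[of "insert (max b (2/3)) R0" "max b (2/3)" t] S
          by auto
        show "mind (insert (max b (2/3)) R0) t \<le> mind S t" if "t \<notin> Z"
          using outR[OF t that] S mind_mono[of "insert (max b (2/3)) R0" R0 t] by auto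
      qed (use iS S in \<open>auto intro!: integrable_mind\<close>)
      moreover have "dist_L (unif (card L0)) \<le> 1 / (216 * real (card L0) ^ 2)"
        using A S by (intro dist_L_unif) (simp add: Suc_leI card_gt_0_iff)
      \<comment> \<open>The margin is 1/27 - 1/36 = 1/108.\<close>
      moreover have "m1 * (e\<^sup>2 - 1/36) + m2 * f\<^sup>2 > 0"
      proof -
        have "m1 * f\<^sup>2 \<le> 2 * m2 * f\<^sup>2" using A by (intro mult_right_mono) auto
        moreover have "m1 * (1/108) \<le> m1 * (e\<^sup>2 + f\<^sup>2 / 2 - 1/36)"
          using ef m by (intro mult_left_mono) auto
        moreover have "m1 * (1/108) > 0" using m False by auto
        ultimately show ?thesis by (simp add: algebra_simps)
      qed
      moreover have "card (insert (max b (2/3)) R0) \<le> Suc (card R0)"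
        using S by (simp add: card_insert_if)
      ultimately have "improvable S"
        using A S S_eq cardS
        by (intro improvableI[of "unif (card L0)" "insert (max b (2/3)) R0"])
           (auto simp: Suc_leI card_gt_0_iff intro!: unif_nonempty)
      then show ?thesis ..
    qed
  next
    case B
    then have R0: "R0 \<noteq> {}" using m2_full m by auto
    have cL: "card (insert (min b (1/3)) L0) \<le> Suc (card L0)"
      using S by (simp add: card_insert_if)
    have dL: "dist_L (insert (min b (1/3)) L0) + m1 * e\<^sup>2 \<le> dist_L S"
      unfolding dist_L_def m1_def
    proof (rule PL.integral_gain_on_set[OF _ _ _ AE_PL])
      fix t :: real assume t: "t \<in> {0..1/3}"
      show "mind (insert (min b (1/3)) L0) t + e\<^sup>2 \<le> mind S t" if "t \<in> Z"
        using inZ[OF that] e_le[OF t] mind_le[of "insert (min b (1/3)) L0" "min b (1/3)" t] S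
        by auto
      show "mind (insert (min b (1/3)) L0) t \<le> mind S t" if "t \<notin> Z"
        using outL[OF t that] S mind_mono[of "insert (min b (1/3)) L0" L0 t] by auto
    qed (use iS S in \<open>auto intro!: integrable_mind\<close>)
    \<comment> \<open>The true margin 2/27 - 1/16 = 5/432 is larger than 1/100; 1/16 is the square
      of the radius 1/4 used for \<open>R0\<close>.\<close>
    have gain: "m2 * (1/100) \<le> m1 * e\<^sup>2 + m2 * (f\<^sup>2 - 1/16)"
    proof -
      have "2 * m2 * e\<^sup>2 \<le> m1 * e\<^sup>2" using B by (intro mult_right_mono) auto
      moreover have "m2 * (1/100) \<le> m2 * (2 * e\<^sup>2 + f\<^sup>2 - 1/16)"
        using ef m by (intro mult_left_mono) auto
      ultimately show ?thesis by (simp add: algebra_simps)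
    qed
    show ?thesis
    \<comment> \<open>The threshold is 2/3 + 1/4: for \<open>a \<le> 11/12\<close>, each
      \<open>t \<ge> 2/3\<close> is within 1/4 of \<open>a\<close> or lies to its right. In the
      latter case \<open>a\<close> is strictly nearer than \<open>b\<close>, so \<open>t\<close> is
      not in \<open>Z\<close>.\<close>
    proof (cases "\<exists>a\<in>R0. a \<le> 11/12")
      case True
      then obtain a where a: "a \<in> R0" "a \<le> 11/12" by blast
      have dR: "dist_R R0 + m2 * (f\<^sup>2 - 1/16) \<le> dist_R S"
        unfolding dist_R_def m2_def
      proof (rule PR.integral_gain_on_set[OF _ _ _ AE_PR])
        fix t :: real assume t: "t \<in> {2/3..1}"
        show "mind R0 t + (f\<^sup>2 - 1/16) \<le> mind S t" if "t \<in> Z"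
        proof (cases "\<bar>t - a\<bar> \<le> 1/4")
          case True
          then have "(t - a)\<^sup>2 \<le> (1/4)\<^sup>2" by (intro abs_le_square_iff[THEN iffD1]) auto
          then show ?thesis
            using mind_le[of R0 a t] a S inZ[OF that] f_le'[OF t] by (simp add: power2_eq_square)
        next
          case False
          then have "a < t" using a t unfolding atLeastAtMost_iff by linarith
          then have "(t - a)\<^sup>2 < (t - b)\<^sup>2"
            using a by (intro power_strict_mono) (auto simp: R0_def)
          then show ?thesis
            using inZ[OF that] mind_le[OF fin, of a t] a by (auto simp: R0_def)
        qed
        show "mind R0 t \<le> mind S t" if "t \<notin> Z"
          using outR[OF t that] by auto
      qed (use iS S R0 in \<open>auto intro!: integrable_mind\<close>)
      show ?thesis
      proof (cases "m2 = 0")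
        case True
        have "dist_L (insert b L0) = dist_L S"
          using S(5,6,7) fin left by (intro dist_cong(1)) simp_all
        then have "splittable S"
          using R0 S S_eq True dR by (intro splittableI[of "insert b L0" R0]) auto
        then show ?thesis ..
      next
        case False
        then have "improvable S"
          using m dL dR gain S S_eq cardS cL R0
          by (intro improvableI[of "insert (min b (1/3)) L0" R0]) auto
        then show ?thesis ..
      qed
    next
      case False
      \<comment> \<open>No point of \<open>R0\<close> is close to \<open>J 2\<close>, so the single point \<open>5/6\<close> already beats all of \<open>R0\<close>.\<close>
      let ?k = "\<lambda>t::real. indicat_real {2/3..7/9} t * (t - 11/12)\<^sup>2"
      have "(\<integral>t. ?k t \<partial>PR) + m2 * (f\<^sup>2 - 1/16) \<le> dist_R S"
        unfolding dist_R_def m2_def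
      proof (rule PR.integral_gain_on_set[OF _ _ _ AE_PR])
        show "integrable PR ?k"
          by (rule Bochner_Integration.integrable_bound[OF integrable_continuous_measures(3)[of "\<lambda>t. (t - 11/12)\<^sup>2"]])
             (auto intro!: continuous_intros AE_I2 simp: indicator_def)
        fix t :: real assume t: "t \<in> {2/3..1}"
        show "?k t + (f\<^sup>2 - 1/16) \<le> mind S t" if "t \<in> Z"
        proof -
          have "\<bar>t - 11/12\<bar> \<le> 1/4" using t unfolding atLeastAtMost_iff by linarith
          then have "(t - 11/12)\<^sup>2 \<le> (1/4)\<^sup>2" by (intro abs_le_square_iff[THEN iffD1]) auto
          then show ?thesis
            using inZ[OF that] f_le'[OF t] by (auto simp: power2_eq_square indicator_def)
        qed
        show "?k t \<le> mind S t" if "t \<notin> Z"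
        proof (cases "t \<le> 7/9")
          case True
          have "(t - 11/12)\<^sup>2 \<le> mind R0 t"
          proof (rule mind_ge)
            fix a assume "a \<in> R0"
            then have "(11/12 - t)\<^sup>2 \<le> (a - t)\<^sup>2"
              using False True by (intro power_mono) force+
            then show "(t - 11/12)\<^sup>2 \<le> (t - a)\<^sup>2" by (simp add: power2_commute)
          qed (use S R0 in auto)
          then show ?thesis
            using outR[OF t that] mind_nonneg[OF fin \<open>S \<noteq> {}\<close>, of t] by (auto simp: indicator_def)
        qed (use mind_nonneg[OF fin \<open>S \<noteq> {}\<close>] in simp)
      qed (use iS in auto)
      moreover have "card R0 \<ge> 1" using R0 S by (simp add: Suc_leI card_gt_0_iff)
      ultimately have "improvable S"
        using m dL gain integral_PR_parabola_lower dist_R_singleton S S_eq cardS cL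
        by (intro improvableI[of "insert (min b (1/3)) L0" "{5/6}"]) auto
      then show ?thesis ..
    qed
  next
    \<comment> \<open>With no point left of \<open>b\<close> there is nothing to rebuild on the
      left. The cell now has left mass 1/2 and right mass at least 1/4, so the error is at least
      (e^2 + f^2/2)/2, hence at least 1/54, which exceeds the error 1/216 + 25/204/18 of 1/6 and 5/6
      each serving its own side.\<close>
    case C
    then have m1: "m1 = 1/2" using m1_full by blast
    have "0 + m1 * e\<^sup>2 \<le> dist_L S"
      using PL.integral_gain_on_set[OF _ iS(2) _ AE_PL, of "\<lambda>_. 0" Z "e\<^sup>2"] e_le' inZ
        mind_nonneg[OF fin \<open>S \<noteq> {}\<close>] by (simp add: dist_L_def m1_def)
    moreover have "0 + m2 * f\<^sup>2 \<le> dist_R S"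
      using PR.integral_gain_on_set[OF _ iS(3) _ AE_PR, of "\<lambda>_. 0" Z "f\<^sup>2"] f_le' inZ
        mind_nonneg[OF fin \<open>S \<noteq> {}\<close>] by (simp add: dist_R_def m2_def)
    moreover have "1/4 * f\<^sup>2 \<le> m2 * f\<^sup>2" using C m1 by (intro mult_right_mono) auto
    moreover have "dist_L {1/6} = 1/216"
      by (simp add: dist_L_def integral_PL_square)
    ultimately have "improvable S"
      using ef(1) m1 card dist_R_singleton S_eq by (intro improvableI[of "{1/6}" "{5/6}"]) auto
    then show ?thesis ..
  qed
qed

text \<open>The points nearest to 1/3 and to 2/3 are ordered. If they differ, cutting
  \<open>S\<close> between them costs nothing; if they agree, that point straddles the gap.\<close>

lemma splittable_or_improvable:
  assumes fin: "finite S" and card: "card S \<ge> 2"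
  shows "splittable S \<or> improvable S"
proof -
  have "S \<noteq> {}" using card by auto
  obtain b where b: "b \<in> S" "mind S (1/3) = (1/3 - b)\<^sup>2"
    using mind_attained[OF fin \<open>S \<noteq> {}\<close>] by blast
  obtain b' where b': "b' \<in> S" "mind S (2/3) = (2/3 - b')\<^sup>2"
    using mind_attained[OF fin \<open>S \<noteq> {}\<close>] by blast
  have "b \<le> b'"
  proof (rule ccontr)
    assume "\<not> b \<le> b'"
    have "(1/3 - b)\<^sup>2 \<le> (1/3 - b')\<^sup>2" "(2/3 - b')\<^sup>2 \<le> (2/3 - b)\<^sup>2"
      using mind_le[OF fin b'(1), of "1/3"] mind_le[OF fin b(1), of "2/3"] b b' by auto
    then show False using \<open>\<not> b \<le> b'\<close> by (simp add: power2_eq_square algebra_simps)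
  qed
  show ?thesis
  proof (cases "b = b'")
    case True
    then show ?thesis using straddle_cases[OF fin card b(1)] b b' by auto
  next
    case False
    have "dist_L {a \<in> S. a \<le> b} = dist_L S"
      using b fin \<open>S \<noteq> {}\<close> mind_left[OF fin b] by (intro dist_cong(1)) auto
    moreover have "dist_R {a \<in> S. b' \<le> a} = dist_R S"
      using b' fin \<open>S \<noteq> {}\<close> mind_right[OF fin b'] by (intro dist_cong(2)) auto
    ultimately have "splittable S"
      using b b' False \<open>b \<le> b'\<close> dist_P_eq[OF fin \<open>S \<noteq> {}\<close>]
      by (intro splittableI[of "{a \<in> S. a \<le> b}" "{a \<in> S. b' \<le> a}"]) auto
    then show ?thesis ..
  qed
qed

section \<open>Canonical sequences\<close>

text \<open>The error of a canonical set in recursive form: 25/204 is the variance of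
  \<open>P\<close>, \<open>1 / (216 * real i ^ 2)\<close> the error of \<open>i\<close> midpoints on
  \<open>J 1\<close>, and 1/18 combines the mass 1/2 with the squared scale 1/9.\<close>

fun cost :: "nat list \<Rightarrow> real" where
  "cost [] = 25/204"
| "cost (i # ms) = 1 / (216 * real i ^ 2) + cost ms / 18"

lemma atLeast1_Suc: "{1..Suc k} = insert 1 (Suc ` {1..k})"
  unfolding image_Suc_atLeastAtMost by (subst atLeastAtMost_insertL) auto

lemma sum_atLeast1_Suc: "sum f {1..Suc k} = f 1 + (\<Sum>j\<in>{1..k}. f (Suc j))"
  for f :: "nat \<Rightarrow> real"
  unfolding atLeast1_Suc
  by (subst sum.insert) (auto simp: sum.reindex simp del: image_Suc_atLeastAtMost)

lemma cost_eq:
  "cost ns = (\<Sum>j\<in>{1..length ns}. 1 / real (ns ! (j - 1)) ^ 2 * (1/12) * (1 / 18 ^ j)) +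
     25/204 * (1 / 18 ^ length ns)"
proof (induction ns)
  case (Cons i ms)
  have "(\<Sum>j\<in>{1..length ms}. 1 / real ((i # ms) ! (Suc j - 1)) ^ 2 * (1/12) * (1 / 18 ^ Suc j)) =
      (\<Sum>j\<in>{1..length ms}. (1 / real (ms ! (j - 1)) ^ 2 * (1/12) * (1 / 18 ^ j)) / 18)"
    by (intro sum.cong) (auto simp: nth_Cons' )
  then have "(\<Sum>j\<in>{1..length (i # ms)}. 1 / real ((i # ms) ! (j - 1)) ^ 2 * (1/12) * (1 / 18 ^ j)) =
      1 / (216 * real i ^ 2) + (\<Sum>j\<in>{1..length ms}. 1 / real (ms ! (j - 1)) ^ 2 * (1/12) * (1 / 18 ^ j)) / 18"
    unfolding list.size add_0_right sum_atLeast1_Suc[of _ "length ms"] add_Suc_right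
    by (simp add: sum_divide_distrib)
  then show ?case
    by (simp only: cost.simps Cons.IH) (simp add: add_divide_distrib)
qed simp

lemma cost_update:
  "j < length ns \<Longrightarrow>
    cost (ns[j := v]) = cost ns + (1 / real v ^ 2 - 1 / real (ns ! j) ^ 2) / (12 * 18 ^ Suc j)"
proof (induction ns arbitrary: j)
  case (Cons i ms)
  then show ?case
    by (cases j) (auto simp: diff_divide_distrib add_divide_distrib)
qed simp

text \<open>Splitting the tail replaces 25/204 by 1/216 + 25/204/18, a drop of 24/216 =
  2/18.\<close>

lemma cost_snoc_1: "cost (ns @ [1]) = cost ns - 2 / 18 ^ Suc (length ns)"
  by (induction ns) (auto simp: diff_divide_distrib add_divide_distrib)

lemma cost_snoc_update:
  "cost (ns @ [v]) = cost (ns @ [w]) + (1 / real v ^ 2 - 1 / real w ^ 2) / (12 * 18 ^ Suc (length ns))"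
  using cost_update[of "length ns" "ns @ [w]" v] by simp

lemma VA_eq_cost:
  assumes "m \<in> {1..length ns}"
  shows "VA ns m = cost (ns[m - 1 := ns ! (m - 1) + 1])"
proof -
  let ?ns = "ns[m - 1 := ns ! (m - 1) + 1]"
  have "(\<Sum>j\<in>{1..length ns}. 1 / real (?ns ! (j - 1)) ^ 2 * (1/12) * (1 / 18 ^ j)) =
      1 / real (?ns ! (m - 1)) ^ 2 * (1/12) * (1 / 18 ^ m) +
      (\<Sum>j\<in>{1..length ns} - {m}. 1 / real (?ns ! (j - 1)) ^ 2 * (1/12) * (1 / 18 ^ j))"
    using assms by (intro sum.remove) auto
  also have "(\<Sum>j\<in>{1..length ns} - {m}. 1 / real (?ns ! (j - 1)) ^ 2 * (1/12) * (1 / 18 ^ j)) =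
      (\<Sum>j\<in>{1..length ns} - {m}. 1 / real (ns ! (j - 1)) ^ 2 * (1/12) * (1 / 18 ^ j))"
    using assms by (intro sum.cong refl) (auto simp: nth_list_update)
  also have "?ns ! (m - 1) = ns ! (m - 1) + 1"
    using assms by (intro nth_list_update_eq) auto
  finally show ?thesis
    unfolding cost_eq VA_def by simp
qed

lemma Vinf_eq_cost: "Vinf ns = cost (ns @ [1])"
  unfolding cost_snoc_1 Vinf_def cost_eq[of ns] by simp

section \<open>Diminishing gains and the greedy step\<close>

text \<open>The gap factors as (1/x) * (1/(x+1)) * (1/x + 1/(x+1)), and every factor decreases in x.
  Thus each further point in a block gains less.\<close>

lemma inverse_square_gap_antimono:
  assumes "1 \<le> u" "u \<le> w"
  shows "1 / real w ^ 2 - 1 / (real w + 1) ^ 2 \<le> 1 / real u ^ 2 - 1 / (real u + 1) ^ 2"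
proof -
  have eq: "1 / x ^ 2 - 1 / (x + 1) ^ 2 = (1 / x) * (1 / (x + 1)) * (1 / x + 1 / (x + 1))"
    if "x > 0" for x :: real
  proof -
    have "1 / x - 1 / (x + 1) = (1 / x) * (1 / (x + 1))"
      using that by (simp add: field_simps)
    then show ?thesis
      by (metis (no_types, opaque_lifting) mult.commute power_one_over square_diff_square_factored power2_eq_square)
  qed
  have "1 / real w \<le> 1 / real u" "1 / (real w + 1) \<le> 1 / (real u + 1)"
    using assms by (auto simp: frac_le)
  then have "(1 / real w) * (1 / (real w + 1)) * (1 / real w + 1 / (real w + 1)) \<le>
      (1 / real u) * (1 / (real u + 1)) * (1 / real u + 1 / (real u + 1))"
    by (intro mult_mono add_mono) auto
  then show ?thesis
    using assms eq[of "real w"] eq[of "real u"] by simp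
qed

lemma sum_list_mono_nth:
  fixes xs ys :: "nat list"
  assumes "length xs \<le> length ys" "\<And>j. j < length xs \<Longrightarrow> xs ! j \<le> ys ! j"
  shows "sum_list xs \<le> sum_list ys"
proof -
  have "sum_list xs \<le> (\<Sum>j<length xs. ys ! j)"
    unfolding sum_list_sum_nth atLeast0LessThan using assms by (intro sum_mono) auto
  also have "\<dots> \<le> (\<Sum>j<length ys. ys ! j)"
    using assms by (intro sum_mono2) auto
  finally show ?thesis
    by (simp add: sum_list_sum_nth atLeast0LessThan)
qed

lemma cost_increment_less:
  assumes "j < length ns" "1 \<le> ns ! j"
  shows "cost (ns[j := ns ! j + 1]) < cost ns"
proof -
  have "1 / real (ns ! j + 1) ^ 2 < 1 / real (ns ! j) ^ 2"
    using assms by (intro divide_strict_left_mono power_strict_mono mult_pos_pos) auto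
  then have "(1 / real (ns ! j + 1) ^ 2 - 1 / real (ns ! j) ^ 2) / (12 * 18 ^ Suc j) < 0"
    by (simp add: divide_neg_pos)
  then show ?thesis
    using cost_update[OF assms(1), of "ns ! j + 1"] by linarith
qed

lemma Vmin_le:
  shows "m \<in> {1..length ns} \<Longrightarrow> Vmin ns \<le> VA ns m" "Vmin ns \<le> Vinf ns"
  unfolding Vmin_def by (auto intro!: min.coboundedI1)

text \<open>
  Any competitor \<open>ms\<close> of total one more than \<open>ns\<close> exceeds \<open>ns\<close> in some block or is longer; undoing
  that excess gives a competitor of \<open>ns\<close>, and the same move made from \<open>ns\<close> gains at least as much.
\<close>

lemma greedy_step:
  assumes pos: "\<forall>i\<in>set ns. 1 \<le> i" and "ns \<noteq> []"
    and opt: "\<And>ms. \<forall>i\<in>set ms. 1 \<le> i \<Longrightarrow> sum_list ms \<le> sum_list ns \<Longrightarrow> cost ns \<le> cost ms"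
    and ms: "\<forall>i\<in>set ms. 1 \<le> i" "sum_list ms \<le> Suc (sum_list ns)"
  shows "Vmin ns \<le> cost ms"
proof -
  consider (inc) j where "j < length ns" "j < length ms" "ns ! j < ms ! j"
    | (longer) "length ns < length ms" | (le) "sum_list ms \<le> sum_list ns"
    using sum_list_mono_nth[of ms ns] by (metis not_le order_less_le_trans)
  then show ?thesis
  proof cases
    case inc
    define w where "w = ms ! j - 1"
    define u where "u = ns ! j"
    have u: "1 \<le> u" "u \<le> w" "ms ! j = Suc w"
      using inc pos by (auto simp: u_def w_def)
    let ?ms = "ms[j := w]"
    have "\<forall>i\<in>set ?ms. 1 \<le> i"
      using ms(1) u set_update_subset_insert[of ms j w] by auto
    moreover have "sum_list ?ms \<le> sum_list ns"
      using ms(2) inc u by (simp add: sum_list_update)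
    ultimately have "cost ns \<le> cost ?ms" by (rule opt)
    moreover have "cost ?ms = cost ms + (1 / real w ^ 2 - 1 / (real w + 1) ^ 2) / (12 * 18 ^ Suc j)"
      using cost_update[OF inc(2), of w] u by (simp add: add.commute)
    moreover have "cost (ns[j := ns ! j + 1]) =
        cost ns - (1 / real u ^ 2 - 1 / (real u + 1) ^ 2) / (12 * 18 ^ Suc j)"
      using cost_update[OF inc(1), of "ns ! j + 1"]
      by (simp add: u_def diff_divide_distrib add.commute)
    moreover have "(1 / real w ^ 2 - 1 / (real w + 1) ^ 2) / (12 * 18 ^ Suc j) \<le>
        (1 / real u ^ 2 - 1 / (real u + 1) ^ 2) / (12 * 18 ^ Suc j)"
      by (intro divide_right_mono inverse_square_gap_antimono u) auto
    moreover have "Vmin ns \<le> cost (ns[j := ns ! j + 1])"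
      using Vmin_le(1)[of "Suc j" ns] VA_eq_cost[of "Suc j" ns] inc by simp
    ultimately show ?thesis by linarith
  next
    case longer
    then obtain xs l where xl: "ms = xs @ [l]"
      by (metis list.size(3) not_less_zero rev_exhaust)
    have le: "(1::real) / 18 ^ Suc (length xs) \<le> 1 / 18 ^ Suc (length ns)"
      using longer xl by (intro divide_left_mono power_increasing) auto
    have "cost ns - 2 / 18 ^ Suc (length xs) \<le> cost ms"
    proof (cases "l = 1")
      case True
      then have "cost ns \<le> cost xs" using ms xl by (intro opt) auto
      then show ?thesis using cost_snoc_1[of xs] True xl by simp
    next
      case False
      then have l: "l \<ge> 2" using ms xl by auto
      then have "cost ns \<le> cost (xs @ [l - 1])" using ms xl by (intro opt) auto
      moreover have "cost ms = cost (xs @ [l - 1]) +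
          (1 / real l ^ 2 - 1 / real (l - 1) ^ 2) / (12 * 18 ^ Suc (length xs))"
        unfolding xl by (rule cost_snoc_update)
      \<comment> \<open>The numerator is at least -1; it is relaxed to -24 because 24/12 = 2
        reproduces the gain in \<open>cost_snoc_1\<close>, so both values of \<open>l\<close> end in
        the same estimate.\<close>
      moreover have "(1 / real l ^ 2 - 1 / real (l - 1) ^ 2) / (12 * 18 ^ Suc (length xs)) \<ge>
          (- 24) / (12 * 18 ^ Suc (length xs))"
      proof (rule divide_right_mono)
        have "1 / real (l - 1) ^ 2 \<le> 1" using l by simp
        moreover have "0 \<le> 1 / real l ^ 2" by simp
        ultimately show "- 24 \<le> 1 / real l ^ 2 - 1 / real (l - 1) ^ 2" by linarith
      qed auto
      ultimately show ?thesis by simp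
    qed
    moreover have "Vmin ns \<le> cost ns - 2 / 18 ^ Suc (length ns)"
      using Vmin_le(2)[of ns] unfolding Vinf_eq_cost cost_snoc_1 .
    ultimately show ?thesis using le by linarith
  next
    case le
    then have "cost ns \<le> cost ms" using ms(1) by (intro opt)
    moreover have "Vmin ns \<le> cost (ns[0 := ns ! 0 + 1])"
      using Vmin_le(1)[of 1 ns] VA_eq_cost[of 1 ns] \<open>ns \<noteq> []\<close> by (simp add: Suc_leI)
    moreover have "cost (ns[0 := ns ! 0 + 1]) < cost ns"
      using pos \<open>ns \<noteq> []\<close> by (intro cost_increment_less) auto
    ultimately show ?thesis by linarith
  qed
qed

section \<open>Sets with prescribed block counts\<close>

text \<open>Fixes the number of points per block and the final point (the mean 1/2, rescaled) but
  leaves positions inside blocks free. Both optimal sets and the explicit \<open>canon_set\<close>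
  fit this shape.\<close>

inductive canon :: "real set \<Rightarrow> nat list \<Rightarrow> bool" where
  canon_Nil: "canon {1/2} []"
| canon_Cons: "finite L \<Longrightarrow> L \<noteq> {} \<Longrightarrow> L \<subseteq> {0..1/3} \<Longrightarrow> canon R ms \<Longrightarrow>
    canon (L \<union> tmap ` R) (card L # ms)"

lemma inj_tmap: "inj tmap"
  by (auto simp: inj_def tmap_def)

lemma card_Un_tmap:
  assumes "finite L" "finite R" "L \<subseteq> {0..1/3}" "R \<subseteq> {0..1}"
  shows "card (L \<union> tmap ` R) = card L + card R"
proof -
  have "x \<le> 1/3" if "x \<in> L" for x using that assms(3) by auto
  moreover have "2/3 \<le> tmap x" if "x \<in> R" for x using that assms(4) by (auto simp: tmap_def)
  ultimately have "L \<inter> tmap ` R = {}" by fastforce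
  then show ?thesis
    using assms by (simp add: card_Un_disjoint card_image inj_on_subset[OF inj_tmap])
qed

lemma canon_props:
  assumes "canon S ms"
  shows "finite S \<and> S \<noteq> {} \<and> S \<subseteq> {0..1} \<and> card S = Suc (sum_list ms) \<and> (\<forall>i\<in>set ms. 1 \<le> i)"
  using assms
proof induction
  case (canon_Cons L R ms)
  then have "tmap ` R \<subseteq> {0..1}" by (auto simp: tmap_def)
  moreover have "L \<subseteq> {0..1}" using canon_Cons by force
  ultimately show ?case
    using canon_Cons by (auto simp: card_Un_tmap Suc_leI card_gt_0_iff)
qed auto

definition blocks_match :: "real set \<Rightarrow> nat list \<Rightarrow> bool" where
  "blocks_match S ns \<longleftrightarrow>
     (\<forall>j\<in>{1..length ns}. S \<inter> J j \<noteq> {} \<and> card (S \<inter> J j) = ns ! (j - 1)) \<and>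
     card (S \<inter> {1 - 1 / 3 ^ length ns .. 1}) = 1"

lemma canonical_seq_iff: "canonical_seq S ns \<longleftrightarrow> ns \<noteq> [] \<and> blocks_match S ns"
  by (simp add: canonical_seq_def blocks_match_def)

text \<open>\<open>tmap\<close> carries \<open>J j\<close> onto \<open>J (Suc j)\<close> and each
  tail interval onto the next, while \<open>L\<close> meets none of these images.\<close>

lemma blocks_match_Cons:
  assumes L: "L \<noteq> {}" "L \<subseteq> {0..1/3}" and R: "R \<subseteq> {0..1}"
  shows "blocks_match (L \<union> tmap ` R) (i # ns) \<longleftrightarrow> i = card L \<and> blocks_match R ns"
proof -
  have ge: "tmap x \<ge> 2/3" if "x \<in> R" for x using that R by (auto simp: tmap_def)
  have 1: "(L \<union> tmap ` R) \<inter> J 1 = L"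
    unfolding J_1 using L ge by force
  have 2: "(L \<union> tmap ` R) \<inter> J (Suc j) = tmap ` (R \<inter> J j)" if "j \<ge> 1" for j
  proof -
    have "x \<notin> J (Suc j)" if "x \<in> L" for x
    proof
      assume "x \<in> J (Suc j)"
      moreover have "tmap (3 * x - 2) = x" by (simp add: tmap_def field_simps)
      ultimately have "3 * x - 2 \<in> J j"
        using tmap_in_J_iff[OF \<open>j \<ge> 1\<close>, of "3 * x - 2"] by simp
      then have "0 \<le> 3 * x - 2" using J_subset_unit[OF \<open>j \<ge> 1\<close>] by auto
      moreover have "x \<le> 1/3" using that L by auto
      ultimately show False by linarith
    qed
    then show ?thesis using tmap_in_J_iff[OF that] by auto
  qed
  have 3: "(L \<union> tmap ` R) \<inter> {1 - 1 / 3 ^ Suc k..1} = tmap ` (R \<inter> {1 - 1 / 3 ^ k..1})" for k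
  proof -
    have "(1::real) / 3 ^ Suc k \<le> 1 / 3" by simp
    then have "x \<notin> {1 - 1 / 3 ^ Suc k..1}" if "x \<le> 1/3" for x :: real
      using that unfolding atLeastAtMost_iff by linarith
    then have "x \<notin> {1 - 1 / 3 ^ Suc k..1}" if "x \<in> L" for x
      using that L by auto
    moreover have "tmap x \<in> {1 - 1 / 3 ^ Suc k..1} \<longleftrightarrow> x \<in> {1 - 1 / 3 ^ k..1}" for x
      by (auto simp: tmap_def field_simps)
    ultimately show ?thesis by auto
  qed
  have c: "card (tmap ` A) = card A" for A
    by (rule card_image[OF inj_on_subset[OF inj_tmap]]) simp
  have Ball: "(\<forall>j\<in>{1..Suc k}. Q j) \<longleftrightarrow> Q 1 \<and> (\<forall>j\<in>{1..k}. Q (Suc j))" for k and Q :: "nat \<Rightarrow> bool"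
    unfolding atLeast1_Suc by blast
  show ?thesis
    unfolding blocks_match_def list.size add_Suc_right add_0_right Ball 1 3 c
    using L(1) by (auto simp: 2 c nth_Cons')
qed

text \<open>Uniqueness of the canonical sequence: neither its length nor its entries can be chosen
  differently.\<close>

lemma blocks_match_canon:
  assumes "canon S ms"
  shows "blocks_match S ns \<longleftrightarrow> ns = ms"
  using assms
proof (induction arbitrary: ns)
  case canon_Nil
  show ?case
  proof (cases ns)
    case (Cons i xs)
    \<comment> \<open>The point 1/2 lies in the first gap, so every nonempty sequence already fails
      at block 1.\<close>
    have "(1/2::real) \<notin> J 1" unfolding J_1 by simp
    then have "\<not> blocks_match {1/2} (i # xs)"
      unfolding blocks_match_def by (auto intro!: bexI[of _ 1] simp del: One_nat_def)
    then show ?thesis using Cons by simp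
  qed (auto simp: blocks_match_def)
next
  case (canon_Cons L R ms)
  note R = canon_props[OF canon_Cons.hyps(4)]
  have "canon (L \<union> tmap ` R) (card L # ms)" using canon_Cons by (intro canon.canon_Cons)
  note S = canon_props[OF this]
  show ?case
  proof (cases ns)
    \<comment> \<open>For the empty sequence the tail interval is all of \<open>{0..1}\<close>, but
      the set has at least two points.\<close>
    case Nil
    have "(L \<union> tmap ` R) \<inter> {0..1} = L \<union> tmap ` R" using S by blast
    moreover have "card (L \<union> tmap ` R) \<noteq> 1" using S by (auto simp: card_eq_0_iff canon_Cons)
    ultimately show ?thesis using Nil by (simp add: blocks_match_def)
  next
    case (Cons i xs)
    then show ?thesis
      using canon_Cons R blocks_match_Cons[of L R i xs] by auto
  qed
qed

lemma canon_set_Nil: "canon_set [] = {1/2}"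
  by (simp add: canon_set_def)

lemma canon_set_Cons: "canon_set (i # ms) = unif i \<union> tmap ` canon_set ms"
proof -
  define B where "B = (\<lambda>(ns::nat list) j. (\<lambda>i. 1 - 1 / 3 ^ (j - 1) +
      (2 * real i - 1) / (2 * real (ns ! (j - 1))) * (1 / 3 ^ j) :: real) ` {1..ns ! (j - 1)})"
  have cs: "canon_set ns = (\<Union>j\<in>{1..length ns}. B ns j) \<union> {1 - 1/2 * (1 / 3 ^ length ns)}" for ns
    unfolding canon_set_def B_def by (simp only: Setcompr_eq_image Collect_mem_eq)
  have "B (i # ms) 1 = unif i" by (simp add: B_def unif_def)
  moreover have "B (i # ms) (Suc j) = tmap ` B ms j" if "j \<in> {1..length ms}" for j
  proof -
    have "j = Suc (j - 1)" using that by auto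
    then obtain k where "j = Suc k" by blast
    then show ?thesis
      unfolding B_def image_image by (intro image_cong) (auto simp: tmap_def field_simps)
  qed
  ultimately have "(\<Union>j\<in>{1..length (i # ms)}. B (i # ms) j) = unif i \<union> tmap ` (\<Union>j\<in>{1..length ms}. B ms j)"
    unfolding list.size add_Suc_right add_0_right atLeast1_Suc UN_insert image_image
    by (simp only: image_UN image_image UN_simps cong: SUP_cong)
  moreover have "1 - 1/2 * (1 / 3 ^ length (i # ms)) = tmap (1 - 1/2 * (1 / 3 ^ length ms))"
    by (simp add: tmap_def field_simps)
  ultimately show ?thesis
    unfolding cs by (simp only: image_Un image_insert image_empty Un_assoc)
qed

lemma canon_canon_set:
  assumes "\<forall>i\<in>set ms. 1 \<le> i"
  shows "canon (canon_set ms) ms"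
  using assms
proof (induction ms)
  case Nil
  then show ?case by (simp add: canon_set_Nil canon_Nil)
next
  case (Cons i ms)
  then show ?case
    using canon_Cons[of "unif i" "canon_set ms" ms] unif_subset[of i] by (simp add: canon_set_Cons)
qed

lemma dist_P_canon_set_le:
  assumes "\<forall>i\<in>set ms. 1 \<le> i"
  shows "dist_P (canon_set ms) \<le> cost ms"
  using assms
proof (induction ms)
  case Nil
  then show ?case by (simp add: canon_set_Nil dist_P_singleton)
next
  case (Cons i ms)
  have c: "finite (canon_set ms)" "canon_set ms \<noteq> {}"
    using canon_props[OF canon_canon_set, of ms] Cons by auto
  have "dist_P (canon_set (i # ms)) \<le> dist_L (unif i) + dist_R (tmap ` canon_set ms)"
    unfolding canon_set_Cons using c Cons by (intro dist_P_Un_le) auto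
  also have "\<dots> \<le> 1 / (216 * real i ^ 2) + cost ms / 18"
    using c Cons dist_L_unif[of i] by (auto simp: dist_R_tmap_image intro!: add_mono)
  finally show ?case by simp
qed

section \<open>Lower bound for all finite sets and the shape of optimal sets\<close>

lemma tmap_image_inv: "tmap ` (\<lambda>x. 3 * x - 2) ` R = R"
  by (simp add: image_image tmap_def diff_divide_distrib)

lemma card_tmap_inv: "card ((\<lambda>x::real. 3 * x - 2) ` R) = card R"
  by (rule card_image) (auto simp: inj_on_def)

text \<open>Either alternative of \<open>splittable_or_improvable\<close> separates the sides
  without raising the error. As \<open>L\<close> is nonempty, the rescaled \<open>R\<close> has
  fewer points and the induction continues with it.\<close>

lemma dist_P_ge_cost:
  assumes "finite S" "S \<noteq> {}"
  shows "\<exists>ms. (\<forall>i\<in>set ms. 1 \<le> i) \<and> Suc (sum_list ms) \<le> card S \<and> cost ms \<le> dist_P S"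
  using assms
proof (induction "card S" arbitrary: S rule: less_induct)
  case less
  show ?case
  proof (cases "card S \<ge> 2")
    case False
    then have "card S = 1" using less.prems by (metis Suc_1 card_gt_0_iff not_less_eq_eq le_antisym One_nat_def Suc_leI)
    then obtain a where "S = {a}" using card_1_singletonE by blast
    then show ?thesis by (intro exI[of _ "[]"]) (simp add: dist_P_singleton)
  next
    case True
    obtain L R where LR: "finite L" "finite R" "L \<noteq> {}" "R \<noteq> {}" "card L + card R \<le> card S"
      "dist_L L + dist_R R \<le> dist_P S"
      using splittable_or_improvable[OF less.prems(1) True]
    proof
      assume "splittable S"
      then obtain L R where *: "L \<noteq> {}" "R \<noteq> {}" "L \<subseteq> S" "R \<subseteq> S" "L \<inter> R = {}"
        "dist_L L + dist_R R \<le> dist_P S" unfolding splittable_def by blast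
      then have f: "finite L" "finite R" using less.prems by (auto intro: finite_subset)
      then have "card L + card R \<le> card S"
        using * less.prems card_mono[of S "L \<union> R"] by (simp add: card_Un_disjoint)
      then show thesis using that * f by blast
    next
      assume "improvable S"
      then show thesis using that unfolding improvable_def by (metis less_imp_le)
    qed
    define R' where "R' = (\<lambda>x. 3 * x - 2) ` R"
    have R': "finite R'" "R' \<noteq> {}" "card R' = card R" "tmap ` R' = R"
      using LR by (auto simp: R'_def tmap_image_inv card_tmap_inv)
    have cL: "card L \<ge> 1" using LR by (simp add: Suc_leI card_gt_0_iff)
    then have "card R' < card S" using LR R' by linarith
    from less.hyps[OF this R'(1,2)] obtain ms where
      ms: "\<forall>i\<in>set ms. 1 \<le> i" "Suc (sum_list ms) \<le> card R'" "cost ms \<le> dist_P R'" by blast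
    have "cost (card L # ms) \<le> dist_L L + dist_R R"
      using dist_L_lower[OF LR(1,3)] ms(3) dist_R_tmap_image[OF R'(1,2)] R'(4) by simp
    then show ?thesis
      using ms LR R' cL by (intro exI[of _ "card L # ms"]) auto
  qed
qed

lemma optimal_set_iff:
  "optimal_set n S \<longleftrightarrow> finite S \<and> S \<noteq> {} \<and> card S \<le> n \<and>
     (\<forall>T. finite T \<and> T \<noteq> {} \<and> card T \<le> n \<longrightarrow> dist_P S \<le> dist_P T)"
proof -
  have "distortion S \<le> distortion T \<longleftrightarrow> dist_P S \<le> dist_P T"
    if "finite S" "S \<noteq> {}" "finite T" "T \<noteq> {}" for T
    using that by (simp add: distortion_eq ennreal_le_iff[OF dist_P_nonneg])
  then show ?thesis
    unfolding optimal_set_def by meson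
qed

text \<open>Optimality excludes \<open>improvable\<close>, so \<open>S\<close> splits; exchanges
  then show that all \<open>n\<close> points are used, that the left part has minimal error and
  hence lies in \<open>J 1\<close>, and that the rescaled right part is again optimal.\<close>

lemma optimal_set_canon:
  assumes "optimal_set n S" "n \<ge> 1"
  shows "\<exists>ms. canon S ms \<and> Suc (sum_list ms) = n \<and> dist_P S = cost ms"
  using assms
proof (induction n arbitrary: S rule: less_induct)
  case (less n)
  then have S: "finite S" "S \<noteq> {}" "card S \<le> n"
    and opt: "\<And>T. finite T \<Longrightarrow> T \<noteq> {} \<Longrightarrow> card T \<le> n \<Longrightarrow> dist_P S \<le> dist_P T"
    by (auto simp: optimal_set_iff)
  have optLR: "dist_P S \<le> dist_L L + dist_R R"
    if "finite L" "L \<noteq> {}" "finite R" "R \<noteq> {}" "card L + card R \<le> n" for L R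
    using opt[of "L \<union> R"] dist_P_Un_le[of L R] that card_Un_le[of L R] by fastforce
  have card1: "S = {1/2} \<and> dist_P S = 25/204" if c1: "card S = 1"
  proof -
    obtain a where a: "S = {a}" using card_1_singletonE[OF c1] .
    have "dist_P S \<le> dist_P {1/2}" using less.prems by (intro opt) auto
    then have "(a - 1/2)\<^sup>2 \<le> 0" by (simp add: a dist_P_singleton)
    then show ?thesis using a by (simp add: dist_P_singleton)
  qed
  have c0: "card S \<ge> 1" using S by (simp add: Suc_leI card_gt_0_iff)
  show ?case
  proof (cases "n = 1")
    case True
    then have "card S = 1" using S c0 by auto
    then show ?thesis using card1 True by (intro exI[of _ "[]"]) (auto intro: canon_Nil)
  next
    case False
    then have n: "n \<ge> 2" using less.prems by auto
    \<comment> \<open>A single point has error 25/204, but 1/6 and 5/6 together reach at most 1/216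
      + 25/204/18.\<close>
    have "card S \<noteq> 1"
    proof
      assume "card S = 1"
      moreover have "dist_P S \<le> dist_L (unif 1) + dist_R {5/6}"
        using n by (intro optLR) auto
      moreover have "dist_L (unif 1) \<le> 1/216" using dist_L_unif[of 1] by simp
      ultimately show False using card1 dist_R_singleton by simp
    qed
    then have "card S \<ge> 2" using c0 by linarith
    have "\<not> improvable S"
      unfolding improvable_def using optLR S(3) by (meson le_trans not_less)
    then obtain L R where LR: "L \<noteq> {}" "R \<noteq> {}" "L \<subseteq> S" "R \<subseteq> S" "L \<inter> R = {}"
      "dist_L L + dist_R R \<le> dist_P S"
      using splittable_or_improvable[OF S(1) \<open>card S \<ge> 2\<close>] unfolding splittable_def by blast
    have f: "finite L" "finite R" using LR S by (auto intro: finite_subset)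
    have cLR: "card (L \<union> R) = card L + card R" using LR f by (simp add: card_Un_disjoint)
    have cle: "card (L \<union> R) \<le> card S" using LR S by (intro card_mono) auto
    have cL: "card L \<ge> 1" "card R \<ge> 1" using LR f by (auto simp: Suc_leI card_gt_0_iff)
    \<comment> \<open>A spare point could enlarge the left part, which strictly lowers its minimal
      error.\<close>
    have n_eq: "card L + card R = n"
    proof (rule ccontr)
      assume "card L + card R \<noteq> n"
      then have "dist_P S \<le> dist_L (unif (Suc (card L))) + dist_R R"
        using cLR cle S LR f by (intro optLR) auto
      moreover have "dist_L (unif (Suc (card L))) \<le> 1 / (216 * real (Suc (card L)) ^ 2)"
        by (intro dist_L_unif) simp
      moreover have "\<dots> < 1 / (216 * real (card L) ^ 2)"
        using cL by (intro divide_strict_left_mono mult_strict_left_mono power_strict_mono mult_pos_pos) auto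
      ultimately show False using dist_L_lower[of L] f LR by linarith
    qed
    then have "S = L \<union> R" using cLR cle S LR card_subset_eq[of S "L \<union> R"] by auto
    \<comment> \<open>With the left part made uniform, any \<open>T\<close> may stand on the right.
      \<open>T = R\<close> shows that \<open>L\<close> has minimal error; general \<open>T\<close>
      gives optimality of \<open>R'\<close>.\<close>
    have swap: "dist_P S \<le> 1 / (216 * real (card L) ^ 2) + dist_R T"
      if "finite T" "T \<noteq> {}" "card T \<le> card R" for T
      using optLR[of "unif (card L)" T] dist_L_unif[of "card L"] that cL n_eq by auto
    have dL: "dist_L L = 1 / (216 * real (card L) ^ 2)"
      using swap[of R] dist_L_lower[of L] LR f by auto
    have L_sub: "L \<subseteq> {0..1/3}"
      using dist_L_lower_strict[of L] dL LR f by (metis less_irrefl)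
    define R' where "R' = (\<lambda>x. 3 * x - 2) ` R"
    have R': "finite R'" "R' \<noteq> {}" "card R' = card R" "tmap ` R' = R"
      using LR f by (auto simp: R'_def tmap_image_inv card_tmap_inv)
    have "optimal_set (card R) R'"
      unfolding optimal_set_iff
    proof (intro conjI allI impI)
      fix T :: "real set" assume T: "finite T \<and> T \<noteq> {} \<and> card T \<le> card R"
      then have "dist_P S \<le> 1 / (216 * real (card L) ^ 2) + dist_R (tmap ` T)"
        by (intro swap) (auto intro: order_trans[OF card_image_le])
      then have "dist_R R \<le> dist_R (tmap ` T)" using LR dL by linarith
      then show "dist_P R' \<le> dist_P T"
        using T R' dist_R_tmap_image[of R'] dist_R_tmap_image[of T] by auto
    qed (use R' in auto)
    then obtain ms where ms: "canon R' ms" "Suc (sum_list ms) = card R" "dist_P R' = cost ms"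
      using less.IH[of "card R" R'] n_eq cL by auto
    have "dist_P S = dist_L L + dist_R R"
      using LR swap[of R] dL f by auto
    then have "dist_P S = cost (card L # ms)"
      using dL ms(3) dist_R_tmap_image[of R'] R' by simp
    moreover have "canon S (card L # ms)"
      using canon_Cons[OF f(1) LR(1) L_sub ms(1)] R' \<open>S = L \<union> R\<close> by simp
    moreover have "Suc (sum_list (card L # ms)) = n" using n_eq ms by simp
    ultimately show ?thesis by blast
  qed
qed

text \<open>Common form of both conclusions: \<open>ns'\<close> has total one more than
  \<open>ns\<close> and its cost is \<open>Vmin ns\<close>, which by \<open>greedy_step\<close> and
  \<open>dist_P_ge_cost\<close> bounds every competitor from below.\<close>

lemma optimal_set_canon_set:
  assumes "optimal_set n S" "canon S ns" "n \<ge> 2"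
    and pos: "\<forall>i\<in>set ns'. 1 \<le> i" and sum: "sum_list ns' = Suc (sum_list ns)"
    and min: "Vmin ns = cost ns'" and "ns' \<noteq> []"
  shows "optimal_set (n + 1) (canon_set ns') \<and> canonical_seq (canon_set ns') ns'"
proof -
  obtain ms where ms: "canon S ms" "Suc (sum_list ms) = n" "dist_P S = cost ms"
    using optimal_set_canon[OF assms(1)] assms(3) by auto
  \<comment> \<open>The sequence obtained from optimality and the given one match the same set,
    hence coincide.\<close>
  then have ns: "Suc (sum_list ns) = n" "dist_P S = cost ns"
    using blocks_match_canon[of S ms ns] blocks_match_canon[of S ns ns] assms(2) by auto
  note props = canon_props[OF assms(2)]
  have "ns \<noteq> []" using ns(1) assms(3) by auto
  have opt: "cost ns \<le> cost ms" if "\<forall>i\<in>set ms. 1 \<le> i" "sum_list ms \<le> sum_list ns" for ms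
    using assms(1) canon_props[OF canon_canon_set[OF that(1)]] dist_P_canon_set_le[OF that(1)] that(2) ns
    unfolding optimal_set_iff by (metis Suc_le_mono order_trans)
  note c = canon_props[OF canon_canon_set[OF pos]]
  have "optimal_set (n + 1) (canon_set ns')"
    unfolding optimal_set_iff
  proof (intro conjI allI impI)
    fix T :: "real set" assume T: "finite T \<and> T \<noteq> {} \<and> card T \<le> n + 1"
    then obtain ms where ms: "\<forall>i\<in>set ms. 1 \<le> i" "Suc (sum_list ms) \<le> card T" "cost ms \<le> dist_P T"
      using dist_P_ge_cost by blast
    have "Vmin ns \<le> cost ms"
      using props \<open>ns \<noteq> []\<close> opt ms T ns by (intro greedy_step) auto
    then show "dist_P (canon_set ns') \<le> dist_P T"
      using dist_P_canon_set_le[OF pos] min ms by linarith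
  qed (use c sum ns in auto)
  moreover have "canonical_seq (canon_set ns') ns'"
    using blocks_match_canon[OF canon_canon_set[OF pos]] \<open>ns' \<noteq> []\<close> by (simp add: canonical_seq_iff)
  ultimately show ?thesis ..
qed

theorem theorem4p14:
  fixes n :: nat and \<alpha> :: "real set" and ns :: "nat list"
  assumes "n \<ge> 2"
    and "optimal_set n \<alpha>"
    and "canonical_seq \<alpha> ns"
  shows "(\<forall>m\<in>{1..length ns}. Vmin ns = VA ns m \<longrightarrow>
            (let ns' = ns[m - 1 := ns ! (m - 1) + 1] in
              optimal_set (n + 1) (canon_set ns') \<and> canonical_seq (canon_set ns') ns'))
       \<and> (Vmin ns = Vinf ns \<longrightarrow>
            optimal_set (n + 1) (canon_set (ns @ [1])) \<and>
            canonical_seq (canon_set (ns @ [1])) (ns @ [1]))"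
proof -
  obtain ms where "canon \<alpha> ms"
    using optimal_set_canon[OF assms(2)] assms(1) by auto
  then have canon: "canon \<alpha> ns" and "ns \<noteq> []"
    using blocks_match_canon assms(3) by (auto simp: canonical_seq_iff)
  have pos: "\<forall>i\<in>set ns. 1 \<le> i" using canon_props[OF canon] by blast
  note opt = optimal_set_canon_set[OF assms(2) canon assms(1)]
  show ?thesis
  proof (intro conjI ballI impI)
    fix m assume m: "m \<in> {1..length ns}" "Vmin ns = VA ns m"
    then have "m - 1 < length ns" by auto
    then show "let ns' = ns[m - 1 := ns ! (m - 1) + 1] in
        optimal_set (n + 1) (canon_set ns') \<and> canonical_seq (canon_set ns') ns'"
      unfolding Let_def
      using m pos \<open>ns \<noteq> []\<close> VA_eq_cost[OF m(1)] set_update_subset_insert[of ns "m - 1" "ns ! (m - 1) + 1"]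
      by (intro opt) (auto simp: sum_list_update elem_le_sum_list)
  next
    assume "Vmin ns = Vinf ns"
    then have "optimal_set (n + 1) (canon_set (ns @ [1])) \<and>
        canonical_seq (canon_set (ns @ [1])) (ns @ [1])"
      using pos by (intro opt) (auto simp: Vinf_eq_cost)
    then show "optimal_set (n + 1) (canon_set (ns @ [1]))"
      "canonical_seq (canon_set (ns @ [1])) (ns @ [1])" by auto
  qed
qed

end
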